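(* Let $\alpha\in(0,1)$ and let $Z_\alpha$ be the positive $\alpha$-stable random variable normalized by $\mathbb{E}[e^{-\lambda Z_\alpha}]=e^{-\lambda^\alpha}$ for all $\lambda\ge 0$. Then $Z_\alpha$ is MSU if and only if $\alpha\le 1/2$.
   Context: A positive random variable $X$ is called MSU (multiplicative strongly unimodal) if and only if it is absolutely continuous with a density $f_X$ on $(0,\infty)$ such that $t\mapsto f_X(e^t)$ is log-concave on $\mathbb{R}$. For every $\alpha\in(0,1)$, $Z_\alpha$ has a smooth density $f_\alpha$ on $(0,\infty)$, characterized by $\int_0^\infty e^{-\lambda t}f_\alpha(t)\,dt=e^{-\lambda^\alpha}$ for all $\lambda\ge 0$. *)

theory Defs
  imports "HOL-Probability.Probability"
begin

(* The logarithm of 0 is read as minus infinity, so concavity of "ln g" as a function with values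
   in [-\<infinity>, \<infinity>) means that the set where g > 0 is convex (part of "concave_on") and that
   "ln g" is concave there.  The restriction matters because "ln 0 = 0" in HOL. *)
definition log_concave :: "(real \<Rightarrow> real) \<Rightarrow> bool" where
  "log_concave g \<longleftrightarrow>
     (\<forall>t. 0 \<le> g t) \<and> concave_on {t. 0 < g t} (\<lambda>t. ln (g t))"

definition positive_rv :: "'a measure \<Rightarrow> ('a \<Rightarrow> real) \<Rightarrow> bool" where
  "positive_rv M X \<longleftrightarrow> X \<in> borel_measurable M \<and> (AE \<omega> in M. 0 < X \<omega>)"

(* A density is only determined up to null sets: X is MSU if some version of it has the
   required property. *)
definition MSU :: "'a measure \<Rightarrow> ('a \<Rightarrow> real) \<Rightarrow> bool" where
  "MSU M X \<longleftrightarrow> positive_rv M X \<and>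
     (\<exists>f :: real \<Rightarrow> real. distributed M lborel X (\<lambda>x. ennreal (f x)) \<and>
          (\<forall>x\<le>0. f x = 0) \<and> log_concave (\<lambda>t. f (exp t)))"

(* The Laplace transform determines the law of a positive random variable.  The Bochner integral
   is a genuine expectation here, since the integrand lies between 0 and 1 almost everywhere. *)
definition positive_stable :: "'a measure \<Rightarrow> real \<Rightarrow> ('a \<Rightarrow> real) \<Rightarrow> bool" where
  "positive_stable M \<alpha> Z \<longleftrightarrow> positive_rv M Z \<and>
     (\<forall>l\<ge>0. (\<integral>\<omega>. exp (- l * Z \<omega>) \<partial>M) = exp (- (l powr \<alpha>)))"

end

(* The theorem rests on Andreief's identity for integrals of products of 2x2 determinants.

   If Z is MSU and K is multiplicatively log-concave, then l |-> E K(l Z) is multiplicatively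
   log-concave as well.  For K(x) = (1 - exp(-x))^2 this function is
   1 - 2 exp(-y) + exp(-c y) with y = l^alpha and c = 2^alpha, and its expansion at y = 0 violates
   log-concavity as soon as c^2 > 2.

   Conversely, by Kanter's factorization the law of ln Z is that of an affine function of
   ln (L / A(U)), whose density at t is proportional to exp(t) q(exp(t)) with
   q(s) = INT_0^pi A(u) exp(-s A(u)) du.  The function A has an explicit antiderivative m, and if
   alpha <= 1/2, then ln A is a convex function of ln m.  Integrating by parts,
   -s q'(s) / q(s) is the inverse of a mean of the increasing function d ln A / d ln m under weights
   that move to the left as s grows, so it increases, which is the log-concavity of q(exp(t)).

   Kanter's factorization itself is obtained from the moments n! / Gamma(1 + alpha n) of Z^(-alpha).
   They determine the law, and the corresponding integrals of powers of A have an elementary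
   antiderivative: they are values of a generalized binomial integral along a curve on which the
   integrand is real. *)
theory Submission
  imports Defs "HOL-Real_Asymp.Real_Asymp"
begin

section \<open>Total positivity of order two and an expansion at the origin\<close>

section \<open>Necessity\<close>

text \<open>Andreief's identity: integrating the product of the two determinants over both variables
  gives twice the difference of the two sides. The integral is iterated, and after expansion every
  term splits into a function of \<open>x\<close> times a function of \<open>y\<close>.\<close>

lemma andreief_nonneg:
  fixes f1 f2 g1 g2 :: "'a \<Rightarrow> real"
  assumes [simp]: "integrable M (\<lambda>x. f1 x * g1 x)" "integrable M (\<lambda>x. f1 x * g2 x)"
      "integrable M (\<lambda>x. f2 x * g1 x)" "integrable M (\<lambda>x. f2 x * g2 x)"
    and nonneg: "\<And>x y. x \<in> space M \<Longrightarrow> y \<in> space M \<Longrightarrow>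
      0 \<le> (f1 x * f2 y - f1 y * f2 x) * (g1 x * g2 y - g1 y * g2 x)"
  shows "(\<integral>x. f1 x * g2 x \<partial>M) * (\<integral>x. f2 x * g1 x \<partial>M)
       \<le> (\<integral>x. f1 x * g1 x \<partial>M) * (\<integral>x. f2 x * g2 x \<partial>M)"
proof -
  let ?I = "\<lambda>f g. \<integral>x. f x * g x \<partial>M"
  have inner: "(\<integral>y. (f1 x * f2 y - f1 y * f2 x) * (g1 x * g2 y - g1 y * g2 x) \<partial>M) =
      (f1 x * g1 x) * ?I f2 g2 - (f1 x * g2 x) * ?I f2 g1 - (f2 x * g1 x) * ?I f1 g2 + (f2 x * g2 x) * ?I f1 g1" for x
  proof -
    have "(\<integral>y. (f1 x * f2 y - f1 y * f2 x) * (g1 x * g2 y - g1 y * g2 x) \<partial>M) =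
      (\<integral>y. (f1 x * g1 x) * (f2 y * g2 y) - (f1 x * g2 x) * (f2 y * g1 y)
        - (f2 x * g1 x) * (f1 y * g2 y) + (f2 x * g2 x) * (f1 y * g1 y) \<partial>M)"
      by (rule Bochner_Integration.integral_cong) (auto simp: algebra_simps)
    then show ?thesis by simp
  qed
  have "0 \<le> (\<integral>x. (\<integral>y. (f1 x * f2 y - f1 y * f2 x) * (g1 x * g2 y - g1 y * g2 x) \<partial>M) \<partial>M)"
    by (intro Bochner_Integration.integral_nonneg nonneg)
  also have "\<dots> = 2 * (?I f1 g1 * ?I f2 g2 - ?I f1 g2 * ?I f2 g1)"
    unfolding inner by simp
  finally show ?thesis by simp
qed

text \<open>Since \<open>p + q = b + c\<close>, the points \<open>b\<close> and \<open>c\<close> are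
  convex combinations of \<open>p\<close> and \<open>q\<close> with interchanged weights, so adding
  the two concavity inequalities removes the weights. In the remaining cases a left factor vanishes
  or all four points coincide.\<close>

lemma log_concave_mult_le:
  assumes g: "log_concave g" and "p \<le> b" "b \<le> q" "p + q = b + c"
  shows "g p * g q \<le> g b * g c"
proof (cases "0 < g p \<and> 0 < g q \<and> p < q")
  case False
  have *: "0 \<le> g t" for t using g by (auto simp: log_concave_def)
  show ?thesis
  proof (cases "p < q")
    case True
    then have "g p = 0 \<or> g q = 0" using False *[of p] *[of q] by linarith
    then show ?thesis using *[of b] *[of c] by auto
  next
    case False
    then have "b = p" "c = q" using assms by auto
    then show ?thesis by simp
  qed
next
  case True
  let ?S = "{t. 0 < g t}" and ?h = "\<lambda>t. ln (g t)"
  have conc: "concave_on ?S ?h" using g by (simp add: log_concave_def)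
  define u where "u = (b - p) / (q - p)"
  have u: "0 \<le> u" "u \<le> 1" using True assms by (auto simp: u_def divide_simps)
  have "u * (q - p) = b - p" using True by (simp add: u_def)
  then have b: "b = (1 - u) * p + u * q" and c: "c = (1 - (1 - u)) * p + (1 - u) * q"
    using assms by (auto simp: algebra_simps)
  have S: "convex ?S" using conc by (simp add: concave_on_def convex_on_def)
  have "b \<in> ?S"
    using convexD[OF S, of p q "1 - u" u] True u by (simp add: b)
  moreover have "c \<in> ?S"
    using convexD[OF S, of p q u "1 - u"] True u by (simp add: c)
  moreover have "(1 - u) * ?h p + u * ?h q \<le> ?h b"
    using concave_onD[OF conc, of u p q] True u by (simp add: b)
  moreover have "u * ?h p + (1 - u) * ?h q \<le> ?h c"
    using concave_onD[OF conc, of "1 - u" p q] True u by (simp add: c)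
  ultimately have "?h p + ?h q \<le> ?h b + ?h c" "0 < g b" "0 < g c"
    by (auto simp: algebra_simps)
  then have "ln (g p * g q) \<le> ln (g b * g c)" using True by (simp add: ln_mult)
  then show ?thesis using True \<open>0 < g b\<close> \<open>0 < g c\<close> by simp
qed

lemma MSU_imp_le_half:
  fixes Z :: "'a \<Rightarrow> real"
  assumes "prob_space M" and \<alpha>: "0 < \<alpha>" "\<alpha> < 1"
    and Z: "positive_stable M \<alpha> Z" and msu: "MSU M Z"
  shows "\<alpha> \<le> 1 / 2"
proof (rule ccontr)
  assume "\<not> \<alpha> \<le> 1 / 2"
  interpret prob_space M by fact
  obtain f where dist: "distributed M lborel Z (\<lambda>x. ennreal (f x))"
    and f0: "\<And>x. x \<le> 0 \<Longrightarrow> f x = 0" and lc: "log_concave (\<lambda>t. f (exp t))"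
    using msu by (auto simp: MSU_def)
  have fnn: "0 \<le> f x" for x
  proof (cases "x \<le> 0")
    case False
    have "0 \<le> f (exp (ln x))" using lc unfolding log_concave_def by blast
    then show ?thesis using False by simp
  qed (simp add: f0)
  have [measurable]: "Z \<in> borel_measurable M" "AE \<omega> in M. 0 < Z \<omega>"
    using Z by (auto simp: positive_stable_def positive_rv_def)
  have fm[measurable]: "f \<in> borel_measurable lborel"
    by (rule distributed_real_measurable[OF fnn dist]) 
  have f_int: "integrable lborel f"
    using distributed_integrable[OF dist, of "\<lambda>_. 1"] fnn by simp

  define k where "k = (\<lambda>x::real. 1 - exp (- x))"
  \<comment> \<open>\<open>K\<close> is itself multiplicatively log-concave, and \<open>E K(l Z)\<close> is explicit in terms of the
    Laplace transform of \<open>Z\<close>.\<close>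
  define K where "K = (\<lambda>x. (if x \<le> 0 then 0 else k x ^ 2))"
  \<comment> \<open>So \<open>K (2 * x) / K x = (1 + exp (- x))^2\<close> decreases for
    \<open>x > 0\<close>; this is the form in which the log-concavity of \<open>K\<close>
    enters.\<close>
  have k2: "k (2 * x) = k x * (1 + exp (- x))" for x
    unfolding k_def by (simp add: algebra_simps flip: exp_add)
  have K01: "0 \<le> K x" "K x \<le> 1" for x
    by (auto simp: K_def k_def power_le_one)
  have [measurable]: "K \<in> borel_measurable borel" unfolding K_def k_def by measurable
  define H where "H = (\<lambda>l. \<integral>\<omega>. K (l * Z \<omega>) \<partial>M)"
  define h where "h = (\<lambda>y::real. 1 - 2 * exp (- y) + exp (- (2 powr \<alpha> * y)))"

  have H_h: "H l = h (l powr \<alpha>)" if "0 < l" for l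
  proof -
    have int: "integrable M (\<lambda>\<omega>. exp (- c * Z \<omega>))" if "0 < c" for c
    proof (rule integrable_const_bound[where B = 1])
      show "AE \<omega> in M. norm (exp (- c * Z \<omega>)) \<le> 1"
        using \<open>AE \<omega> in M. 0 < Z \<omega>\<close> by eventually_elim (use that in simp)
    qed measurable
    have L: "(\<integral>\<omega>. exp (- c * Z \<omega>) \<partial>M) = exp (- (c powr \<alpha>))" if "0 < c" for c
      using Z that by (auto simp: positive_stable_def)
    have "H l = (\<integral>\<omega>. 1 - 2 * exp (- l * Z \<omega>) + exp (- (2 * l) * Z \<omega>) \<partial>M)"
      unfolding H_def
    proof (rule integral_cong_AE)
      show "AE \<omega> in M. K (l * Z \<omega>) = 1 - 2 * exp (- l * Z \<omega>) + exp (- (2 * l) * Z \<omega>)"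
        using \<open>AE \<omega> in M. 0 < Z \<omega>\<close>
      proof eventually_elim
        case (elim \<omega>)
        then have "0 < l * Z \<omega>" using \<open>0 < l\<close> by simp
        then show ?case
          by (simp add: K_def k_def power2_eq_square algebra_simps flip: exp_add)
      qed
    qed auto
    also have "\<dots> = 1 - 2 * (\<integral>\<omega>. exp (- l * Z \<omega>) \<partial>M) + (\<integral>\<omega>. exp (- (2 * l) * Z \<omega>) \<partial>M)"
      using int[of l] int[of "2 * l"] \<open>0 < l\<close> by (simp add: prob_space)
    also have "\<dots> = h (l powr \<alpha>)"
      using \<open>0 < l\<close> by (subst L, simp)+ (simp add: h_def powr_mult)
    finally show ?thesis .
  qed

  have H_f: "H l = (\<integral>x. K (l * x) * f x \<partial>lborel)" for l
    unfolding H_def using distributed_integral[OF dist, of "\<lambda>x. K (l * x)"] fnn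
    by (simp add: mult.commute)
  \<comment> \<open>The factor 2 moves from \<open>K\<close> to the density:
    \<open>f (x / 2) / 2\<close> is the density of \<open>2 * Z\<close>.\<close>
  have H_f2: "H (2 * l) = (\<integral>x. K (l * x) * (f (x / 2) / 2) \<partial>lborel)" for l
    unfolding H_f by (subst lborel_integral_real_affine[where c = "1/2" and t = 0])
      (auto simp flip: integral_mult_right_zero intro!: Bochner_Integration.integral_cong)
  have f_int2: "integrable lborel (\<lambda>x. f (x / 2) / 2)"
    using lborel_integrable_real_affine[OF f_int, of "1/2" 0] by simp
  have Kint: "integrable lborel (\<lambda>x. K (l * x) * g x)" if "integrable lborel g" for l g
    using that by (rule Bochner_Integration.integrable_bound)
      (use K01 borel_measurable_integrable[OF that] in
        \<open>auto intro!: AE_I2 mult_left_le_one_le simp: abs_mult\<close>)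

  \<comment> \<open>Andreief's inequality pairs \<open>K (l * x)\<close> and
    \<open>K (2 * l * x)\<close> with the densities of \<open>2 * Z\<close> and \<open>Z\<close>.
    For \<open>0 < x < y\<close> both determinants are nonpositive; for \<open>x \<le> 0\<close> the
    second one is 0.\<close>
  have main: "H l * H (4 * l) \<le> H (2 * l) * H (2 * l)" if l: "0 < l" for l
  proof -
    have step: "0 \<le> (K (l * x) * K (2 * l * y) - K (l * y) * K (2 * l * x)) *
        (f (x / 2) / 2 * f y - f (y / 2) / 2 * f x)" if "x < y" for x y
    proof (cases "0 < x")
      case True
      have pos: "0 < l * x" "0 < l * y" "l * x < l * y" using l True that by auto
      have "K (l * x) * K (2 * l * y) - K (l * y) * K (2 * l * x)
          = (k (l * x) * k (l * y))^2 * ((1 + exp (- (l * y)))^2 - (1 + exp (- (l * x)))^2)"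
        using pos k2[of "l * x"] k2[of "l * y"]
        by (simp add: K_def power_mult_distrib right_diff_distrib mult.assoc)
      also have "\<dots> \<le> 0"
        using pos by (intro mult_nonneg_nonpos) (auto intro!: power_mono)
      finally have 1: "K (l * x) * K (2 * l * y) - K (l * y) * K (2 * l * x) \<le> 0" .
      have "f (exp (ln (x / 2))) * f (exp (ln y)) \<le> f (exp (ln x)) * f (exp (ln (y / 2)))"
        using True that by (intro log_concave_mult_le[OF lc]) (auto simp: ln_div)
      then have "f (x / 2) * f y \<le> f x * f (y / 2)" using True that by simp
      with 1 show ?thesis by (intro mult_nonpos_nonpos) (auto simp: algebra_simps)
    qed (simp add: f0)
    have "(\<integral>x. K (l * x) * f x \<partial>lborel) * (\<integral>x. K (2 * l * x) * (f (x / 2) / 2) \<partial>lborel) \<le>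
       (\<integral>x. K (l * x) * (f (x / 2) / 2) \<partial>lborel) * (\<integral>x. K (2 * l * x) * f x \<partial>lborel)"
    proof (rule andreief_nonneg)
      fix x y :: real
      show "0 \<le> (K (l * x) * K (2 * l * y) - K (l * y) * K (2 * l * x)) *
        (f (x / 2) / 2 * f y - f (y / 2) / 2 * f x)"
        using step[of x y] step[of y x] by (cases x y rule: linorder_cases) (auto simp: algebra_simps)
    qed (intro Kint f_int f_int2)+
    then have "H l * H (2 * (2 * l)) \<le> H (2 * l) * H (2 * l)"
      by (simp only: H_f[symmetric] H_f2[symmetric])
    then show ?thesis by simp
  qed

  define c where "c = 2 powr \<alpha>"
  have c: "1 < c" "c < 2" and c2: "2 < c\<^sup>2"
  proof -
    show "1 < c" using \<alpha> by (simp add: c_def)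
    show "c < 2" using \<alpha> powr_less_mono[of \<alpha> 1 2] by (simp add: c_def)
    have "c\<^sup>2 = 2 powr (2 * \<alpha>)" by (simp add: c_def power2_eq_square flip: powr_add)
    then show "2 < c\<^sup>2" using \<open>\<not> \<alpha> \<le> 1 / 2\<close> powr_less_mono[of 1 "2 * \<alpha>" 2] by simp
  qed
  \<comment> \<open>In the variable \<open>y = l powr \<alpha>\<close>, doubling \<open>l\<close>
    multiplies \<open>y\<close> by \<open>c\<close>.\<close>
  have le: "h y * h (c\<^sup>2 * y) \<le> h (c * y) * h (c * y)" if "0 < y" for y
  proof -
    define l where "l = y powr (1 / \<alpha>)"
    have l: "0 < l" "l powr \<alpha> = y" using that \<alpha> by (auto simp: l_def powr_powr)
    have "(4 * l) powr \<alpha> = c\<^sup>2 * y"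
      using l powr_mult[of 2 2 \<alpha>] by (simp add: powr_mult c_def power2_eq_square)
    moreover have "(2 * l) powr \<alpha> = c * y"
      using l by (simp add: powr_mult c_def)
    ultimately show ?thesis using main[OF l(1)] l by (simp add: H_h)
  qed
  have h: "h = (\<lambda>y. 1 - 2 * exp (- y) + exp (- (c * y)))" by (simp add: h_def c_def)
  \<comment> \<open>\<open>A\<close> and \<open>B\<close> are the coefficients of \<open>y\<close>
    and \<open>y^2\<close> in the expansion of \<open>h\<close> at 0, and \<open>e\<close> is the
    exact second-order remainder divided by \<open>y^2\<close>.\<close>
  define A where "A = 2 - c"
  define B where "B = (c\<^sup>2 - 2) / 2"
  define e where "e = (\<lambda>y. (h y - A * y) / y\<^sup>2)"
  have e: "(e \<longlongrightarrow> B) (at_right 0)"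
    unfolding e_def A_def B_def h by (real_asymp simp: power2_eq_square diff_divide_distrib)
  have e': "((\<lambda>y. e (r * y)) \<longlongrightarrow> B) (at_right 0)" if "0 < r" for r
    by (rule filterlim_compose[OF e]) (use that in real_asymp)
  have h_e: "h y = A * y + e y * y\<^sup>2" if "0 < y" for y
    using that by (simp add: e_def)
  \<comment> \<open>In \<open>h y * h (c\<^sup>2 * y) - h (c * y) * h (c * y)\<close> the terms of
    order \<open>y^2\<close> cancel, and the coefficient of \<open>y^3\<close> is
    \<open>A * B * (c * (c - 1))\<^sup>2\<close>. It is positive for
    \<open>1 < c < 2 < c\<^sup>2\<close>, which contradicts \<open>le\<close>.\<close>
  have "((\<lambda>y. A * (c^4 * e (c\<^sup>2 * y) + c\<^sup>2 * e y - 2 * c^3 * e (c * y))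
        + y * (c^4 * (e y * e (c\<^sup>2 * y) - e (c * y) * e (c * y)))) \<longlongrightarrow>
      A * (c^4 * B + c\<^sup>2 * B - 2 * c^3 * B) + 0 * (c^4 * (B * B - B * B))) (at_right 0)"
    using c by (intro tendsto_intros e e') auto
  also have "A * (c^4 * B + c\<^sup>2 * B - 2 * c^3 * B) + 0 * (c^4 * (B * B - B * B)) = A * B * (c * (c - 1))\<^sup>2"
    by (simp add: power2_eq_square power3_eq_cube power4_eq_xxxx algebra_simps)
  finally have "((\<lambda>y. (h y * h (c\<^sup>2 * y) - h (c * y) * h (c * y)) / y^3) \<longlongrightarrow>
      A * B * (c * (c - 1))\<^sup>2) (at_right 0)"
  proof (rule Lim_transform_eventually)
    show "\<forall>\<^sub>F y in at_right 0. A * (c^4 * e (c\<^sup>2 * y) + c\<^sup>2 * e y - 2 * c^3 * e (c * y))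
        + y * (c^4 * (e y * e (c\<^sup>2 * y) - e (c * y) * e (c * y)))
        = (h y * h (c\<^sup>2 * y) - h (c * y) * h (c * y)) / y^3"
      using eventually_at_right_less[of 0]
    proof eventually_elim
      case (elim y)
      then have "h y * h (c\<^sup>2 * y) - h (c * y) * h (c * y) =
          (A * (c^4 * e (c\<^sup>2 * y) + c\<^sup>2 * e y - 2 * c^3 * e (c * y))
        + y * (c^4 * (e y * e (c\<^sup>2 * y) - e (c * y) * e (c * y)))) * y^3"
        using c h_e[of y] h_e[of "c * y"] h_e[of "c\<^sup>2 * y"] by (simp add: eval_nat_numeral algebra_simps)
      then show ?case using elim by simp
    qed
  qed
  moreover have "\<forall>\<^sub>F y in at_right 0. (h y * h (c\<^sup>2 * y) - h (c * y) * h (c * y)) / y^3 \<le> 0"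
    using eventually_at_right_less[of 0] by eventually_elim (use le in \<open>auto simp: divide_simps\<close>)
  ultimately have "A * B * (c * (c - 1))\<^sup>2 \<le> 0"
    by (rule tendsto_upperbound) simp
  then show False using c c2 by (auto simp: mult_le_0_iff A_def B_def)
qed

section \<open>Gamma integrals, a binomial sum, and laws determined by moments\<close>

section \<open>Gamma integrals and moments\<close>

text \<open>The substitution rule for compact intervals is applied to an exhausting sequence, with
  monotone convergence on both sides.\<close>

lemma nn_integral_exp_substitution:
  fixes f :: "real \<Rightarrow> ennreal"
  assumes [measurable]: "f \<in> borel_measurable borel"
  shows "(\<integral>\<^sup>+x. f x * indicator {0<..} x \<partial>lborel) = (\<integral>\<^sup>+t. f (exp t) * ennreal (exp t) \<partial>lborel)"
proof (rule LIMSEQ_unique)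
  \<comment> \<open>The extra 1 keeps the interval nondegenerate for \<open>n = 0\<close>.\<close>
  let ?A = "\<lambda>n::nat. {exp (- real n - 1)..exp (real n + 1)}"
  have eq: "(\<integral>\<^sup>+x. f x * indicator (?A n) x \<partial>lborel)
      = (\<integral>\<^sup>+t. f (exp t) * ennreal (exp t) * indicator {- real n - 1..real n + 1} t \<partial>lborel)" for n
    by (rule nn_integral_substitution_aux) (auto intro!: derivative_eq_intros continuous_intros)
  show "(\<lambda>n. \<integral>\<^sup>+x. f x * indicator (?A n) x \<partial>lborel) \<longlonglongrightarrow> (\<integral>\<^sup>+x. f x * indicator {0<..} x \<partial>lborel)"
  proof (rule nn_integral_LIMSEQ)
    show "(\<lambda>n. f x * indicator (?A n) x) \<longlonglongrightarrow> f x * indicator {0<..} x" for x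
    proof (cases "0 < x")
      case True
      have "\<forall>\<^sub>F n in sequentially. \<bar>ln x\<bar> \<le> real n"
        using eventually_ge_at_top[of "nat \<lceil>\<bar>ln x\<bar>\<rceil>"] by eventually_elim linarith
      then have "\<forall>\<^sub>F n in sequentially. x \<in> ?A n"
      proof eventually_elim
        case (elim n)
        then have "exp (- real n - 1) \<le> exp (ln x)" "exp (ln x) \<le> exp (real n + 1)"
          by (simp_all only: exp_le_cancel_iff)
        then show ?case using True by simp
      qed
      then have "\<forall>\<^sub>F n in sequentially. f x * indicator (?A n) x = f x * indicator {0<..} x"
        by eventually_elim (use True in simp)
      then show ?thesis by (rule tendsto_eventually)
    next
      case False
      then have "x \<notin> ?A n" for n using exp_gt_zero[of "- real n - 1"] by (auto intro: less_le_trans simp del: exp_gt_zero)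
      then show ?thesis using False by simp
    qed
    show "incseq (\<lambda>n x. f x * indicator (?A n) x)"
      by (auto simp: incseq_def le_fun_def intro!: mult_left_mono split: split_indicator)
         (meson add_right_mono exp_le_cancel_iff of_nat_le_iff order.trans neg_le_iff_le diff_right_mono)+
  qed simp
  show "(\<lambda>n. \<integral>\<^sup>+x. f x * indicator (?A n) x \<partial>lborel) \<longlonglongrightarrow> (\<integral>\<^sup>+t. f (exp t) * ennreal (exp t) \<partial>lborel)"
    unfolding eq
  proof (rule nn_integral_LIMSEQ)
    show "(\<lambda>n. f (exp x) * ennreal (exp x) * indicator {- real n - 1..real n + 1} x) \<longlonglongrightarrow> f (exp x) * ennreal (exp x)" for x
    proof (rule tendsto_eventually)
      show "\<forall>\<^sub>F n in sequentially. f (exp x) * ennreal (exp x) * indicator {- real n - 1..real n + 1} x = f (exp x) * ennreal (exp x)"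
        using eventually_ge_at_top[of "nat \<lceil>\<bar>x\<bar>\<rceil>"]
        by eventually_elim (subst indicator_simps(1), simp, linarith, simp)
    qed
    show "incseq (\<lambda>n x. f (exp x) * ennreal (exp x) * indicator {- real n - 1..real n + 1} x)"
      by (auto simp: incseq_def le_fun_def intro!: mult_left_mono split: split_indicator)
  qed simp
qed

text \<open>The Gamma integral in the logarithmic variable: translating by \<open>- ln r\<close>
  pulls out \<open>r powr - z\<close>, and \<open>exp t\<close> is then the usual variable.\<close>

lemma nn_integral_Gamma_exp:
  fixes r z :: real
  assumes "0 < z" "0 < r"
  shows "(\<integral>\<^sup>+t. ennreal (exp (z * t) * exp (- r * exp t)) \<partial>lborel) = ennreal (Gamma z * r powr - z)"
proof -
  have "(\<integral>\<^sup>+t. ennreal (exp (z * t) * exp (- r * exp t)) \<partial>lborel)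
      = (\<integral>\<^sup>+t. ennreal (exp (z * (- ln r + 1 * t)) * exp (- r * exp (- ln r + 1 * t))) \<partial>lborel)"
    by (subst nn_integral_real_affine[where c = 1 and t = "- ln r"]) auto
  also have "\<dots> = (\<integral>\<^sup>+t. ennreal (r powr - z) * (ennreal (exp (z * t) * exp (- exp t))) \<partial>lborel)"
    using assms by (intro nn_integral_cong)
      (auto simp: powr_def exp_minus exp_diff algebra_simps divide_simps simp flip: ennreal_mult exp_add)
  also have "\<dots> = ennreal (r powr - z) * (\<integral>\<^sup>+t. ennreal (exp (z * t) * exp (- exp t)) \<partial>lborel)"
    by (rule nn_integral_cmult) auto
  also have "(\<integral>\<^sup>+t. ennreal (exp (z * t) * exp (- exp t)) \<partial>lborel)
      = (\<integral>\<^sup>+t. ennreal (exp t powr (z - 1) / exp (exp t)) * ennreal (exp t) \<partial>lborel)"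
    by (intro nn_integral_cong)
       (auto simp: powr_def algebra_simps exp_diff exp_minus divide_simps simp flip: ennreal_mult)
  also have "\<dots> = (\<integral>\<^sup>+t. ennreal (t powr (z - 1) / exp t) * indicator {0<..} t \<partial>lborel)"
    by (rule nn_integral_exp_substitution[symmetric]) auto
  also have "\<dots> = (\<integral>\<^sup>+t. ennreal (indicator {0..} t * t powr (z - 1) / exp t) \<partial>lborel)"
    by (intro nn_integral_cong) (auto split: split_indicator)
  also have "\<dots> = ennreal (Gamma z)"
    using Gamma_conv_nn_integral_real[OF assms(1)] by simp
  finally show ?thesis
    using assms by (simp add: mult.commute Gamma_real_pos flip: ennreal_mult)
qed

text \<open>The case \<open>n = 0\<close> is the reflection formula, and Pascal's rule reduces
  \<open>Suc n\<close> at \<open>\<kappa>\<close> to \<open>n\<close> at \<open>\<kappa>\<close> and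
  at \<open>\<kappa> - 1\<close>. With \<open>\<kappa> = a * n\<close> the sum gives the endpoint
  value in \<open>A_powr_integral\<close>. Since \<open>rGamma\<close> is entire, integer
  \<open>\<kappa>\<close> are covered.\<close>

lemma binomial_sinc_sum:
  "(\<Sum>k\<le>n. real (n choose k) * sinc (pi * (real k - \<kappa>)))
    = fact n * rGamma (1 + \<kappa>) * rGamma (1 + real n - \<kappa>)"
proof (induction n arbitrary: \<kappa>)
  case 0
  show ?case
  proof (cases "\<kappa> = 0")
    case False
    have "complex_of_real (rGamma \<kappa> * rGamma (1 - \<kappa>)) = complex_of_real (sin (pi * \<kappa>) / pi)"
    proof -
      have "1 - complex_of_real \<kappa> = complex_of_real (1 - \<kappa>)" by simp
      then show ?thesis
        using rGamma_reflection_complex[of "complex_of_real \<kappa>"]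
        by (simp only: rGamma_complex_of_real of_real_mult of_real_divide sin_of_real[symmetric])
    qed
    then have "rGamma \<kappa> * rGamma (1 - \<kappa>) = sin (pi * \<kappa>) / pi"
      by (simp only: of_real_eq_iff)
    moreover have "rGamma \<kappa> = \<kappa> * rGamma (1 + \<kappa>)"
      using rGamma_plus1[of \<kappa>] by (simp add: add.commute)
    ultimately show ?thesis using False by (simp add: field_simps)
  qed simp
next
  case (Suc n)
  define S where "S = (\<lambda>x::real. sinc (pi * x))"
  have IH: "(\<Sum>k\<le>n. real (n choose k) * S (real k - \<kappa>))
    = fact n * rGamma (1 + \<kappa>) * rGamma (1 + real n - \<kappa>)" for \<kappa>
    using Suc.IH[of \<kappa>] unfolding S_def .
  have "(\<Sum>k\<le>Suc n. real (Suc n choose k) * S (real k - \<kappa>))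
      = S (- \<kappa>) + (\<Sum>k\<le>n. real (Suc n choose Suc k) * S (real (Suc k) - \<kappa>))"
    by (subst sum.atMost_Suc_shift) simp
  also have "(\<Sum>k\<le>n. real (Suc n choose Suc k) * S (real (Suc k) - \<kappa>))
      = (\<Sum>k\<le>n. real (n choose k) * S (real k - (\<kappa> - 1)))
        + (\<Sum>k\<le>n. real (n choose Suc k) * S (real (Suc k) - \<kappa>))"
    by (simp add: distrib_right sum.distrib algebra_simps)
  also have "S (- \<kappa>) + ((\<Sum>k\<le>n. real (n choose k) * S (real k - (\<kappa> - 1))) 
        + (\<Sum>k\<le>n. real (n choose Suc k) * S (real (Suc k) - \<kappa>)))
      = (\<Sum>k\<le>n. real (n choose k) * S (real k - (\<kappa> - 1))) + (\<Sum>k\<le>Suc n. real (n choose k) * S (real k - \<kappa>))"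
    by (subst sum.atMost_Suc_shift) simp
  also have "(\<Sum>k\<le>Suc n. real (n choose k) * S (real k - \<kappa>)) = (\<Sum>k\<le>n. real (n choose k) * S (real k - \<kappa>))"
    by simp
  also have "(\<Sum>k\<le>n. real (n choose k) * S (real k - (\<kappa> - 1))) + (\<Sum>k\<le>n. real (n choose k) * S (real k - \<kappa>))
      = fact n * rGamma \<kappa> * rGamma (2 + real n - \<kappa>) + fact n * rGamma (1 + \<kappa>) * rGamma (1 + real n - \<kappa>)"
    unfolding IH by (simp add: algebra_simps)
  \<comment> \<open>Both summands become multiples of
    \<open>rGamma (1 + \<kappa>) * rGamma (2 + real n - \<kappa>)\<close>, with factors
    \<open>\<kappa>\<close> and \<open>1 + real n - \<kappa>\<close> whose sum turns
    \<open>fact n\<close> into \<open>fact (Suc n)\<close>.\<close>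
  also have "rGamma \<kappa> = \<kappa> * rGamma (1 + \<kappa>)"
    using rGamma_plus1[of \<kappa>] by (simp add: add.commute)
  also have "rGamma (1 + real n - \<kappa>) = (1 + real n - \<kappa>) * rGamma (2 + real n - \<kappa>)"
    using rGamma_plus1[of "1 + real n - \<kappa>"] by (simp add: algebra_simps)
  finally have "(\<Sum>k\<le>Suc n. real (Suc n choose k) * S (real k - \<kappa>))
      = fact (Suc n) * rGamma (1 + \<kappa>) * rGamma (1 + real (Suc n) - \<kappa>)"
    by (simp add: algebra_simps)
  then show ?case unfolding S_def .
qed

text \<open>The Taylor polynomials of the characteristic function depend on the moments alone, and
  the error is at most \<open>2 * \<bar>t\<bar> ^ n / fact n * c n\<close>. Nonnegativity makes
  \<open>c n\<close> the absolute moment that this bound requires.\<close>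

lemma distr_eqI_moments:
  fixes X :: "'a \<Rightarrow> real" and Y :: "'b \<Rightarrow> real" and c :: "nat \<Rightarrow> real"
  assumes M: "prob_space M" and N: "prob_space N"
    and X: "X \<in> borel_measurable M" "\<And>x. 0 \<le> X x" "\<And>n. (\<integral>\<^sup>+x. ennreal (X x ^ n) \<partial>M) = ennreal (c n)"
    and Y: "Y \<in> borel_measurable N" "\<And>y. 0 \<le> Y y" "\<And>n. (\<integral>\<^sup>+y. ennreal (Y y ^ n) \<partial>N) = ennreal (c n)"
    and c: "\<And>n. 0 \<le> c n" "\<And>t. (\<lambda>n. t ^ n / fact n * c n) \<longlonglongrightarrow> 0"
  shows "distr M borel X = distr N borel Y"
proof (rule Levy_uniqueness)
  show "real_distribution (distr M borel X)" "real_distribution (distr N borel Y)"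
    using assms by (auto intro: prob_space.real_distribution_distr)
  have lim: "(\<lambda>n. \<Sum>k\<le>n. (\<i> * t) ^ k / fact k * c k) \<longlonglongrightarrow> char (distr L borel W) t"
    if L: "prob_space L" and W: "W \<in> borel_measurable L" "\<And>x. 0 \<le> W x"
      "\<And>n. (\<integral>\<^sup>+x. ennreal (W x ^ n) \<partial>L) = ennreal (c n)" for L :: "'c measure" and W t
  proof -
    interpret prob_space L by fact
    have hbi: "has_bochner_integral L (\<lambda>x. W x ^ n) (c n)" for n
      by (rule has_bochner_integral_nn_integral) (use W c(1) in auto)
    then have int: "integrable L (\<lambda>x. W x ^ n)" and exp: "expectation (\<lambda>x. W x ^ n) = c n" for n
      by (auto simp: has_bochner_integral_iff)
    have "(\<lambda>n. (\<Sum>k\<le>n. (\<i> * t) ^ k / fact k * c k) - char (distr L borel W) t) \<longlonglongrightarrow> 0"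
    proof (rule Lim_null_comparison)
      show "\<forall>\<^sub>F n in sequentially. norm ((\<Sum>k\<le>n. (\<i> * t) ^ k / fact k * c k) - char (distr L borel W) t)
          \<le> 2 * (\<bar>t\<bar> ^ n / fact n * c n)"
      proof (rule always_eventually, rule allI)
        fix n
        show "norm ((\<Sum>k\<le>n. (\<i> * t) ^ k / fact k * c k) - char (distr L borel W) t)
          \<le> 2 * (\<bar>t\<bar> ^ n / fact n * c n)"
          using char_approx1'[of n W "distr L borel W" t] int W(1,2)
          by (simp add: exp norm_minus_commute)
      qed
      show "(\<lambda>n. 2 * (\<bar>t\<bar> ^ n / fact n * c n)) \<longlonglongrightarrow> 0"
        using tendsto_mult[OF tendsto_const[of 2] c(2)[of "\<bar>t\<bar>"]] by simp
    qed
    then show ?thesis by (rule LIM_zero_cancel)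
  qed
  show "char (distr M borel X) = char (distr N borel Y)"
    using LIMSEQ_unique[OF lim[OF M X] lim[OF N Y]] by (intro ext)
qed

text \<open>Gamma outgrows every exponential: restricting its integral in the logarithmic variable
  to the unit interval \<open>{ln K..ln K + 1}\<close> bounds \<open>Gamma z\<close> below by a
  constant times \<open>K powr z\<close>, for any \<open>K > 0\<close>.\<close>

lemma power_div_Gamma_tendsto_0:
  fixes a t :: real
  assumes a: "0 < a"
  shows "(\<lambda>n. t ^ n / Gamma (1 + a * real n)) \<longlonglongrightarrow> 0"
proof -
  have Gamma_ge: "K powr z * exp (- K * exp 1) \<le> Gamma z" if "0 < z" "0 < K" for z K :: real
  proof -
    have "ennreal (K powr z * exp (- K * exp 1)) = (\<integral>\<^sup>+x. ennreal (K powr z * exp (- K * exp 1)) * indicator {ln K..ln K + 1} x \<partial>lborel)"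
      by (subst nn_integral_cmult_indicator) auto
    also have "\<dots> \<le> (\<integral>\<^sup>+x. ennreal (exp (z * x) * exp (- 1 * exp x)) \<partial>lborel)"
    proof (rule nn_integral_mono)
      fix x
      have "K powr z * exp (- K * exp 1) \<le> exp (z * x) * exp (- 1 * exp x)" if x: "ln K \<le> x" "x \<le> ln K + 1"
      proof (rule mult_mono)
        show "K powr z \<le> exp (z * x)" using x \<open>0 < z\<close> \<open>0 < K\<close> by (simp add: powr_def)
        have "exp x \<le> exp (ln K + 1)" using x by simp
        then show "exp (- K * exp 1) \<le> exp (- 1 * exp x)" using \<open>0 < K\<close> by (simp add: exp_add)
      qed auto
      then show "ennreal (K powr z * exp (- K * exp 1)) * indicator {ln K..ln K + 1} x \<le> ennreal (exp (z * x) * exp (- 1 * exp x))"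
        by (auto split: split_indicator intro!: ennreal_leI)
    qed
    also have "\<dots> = ennreal (Gamma z)"
      using nn_integral_Gamma_exp[of z 1] that by simp
    finally show ?thesis using that by (simp add: Gamma_real_pos less_imp_le)
  qed
  \<comment> \<open>Then \<open>K powr a = 2 * \<bar>t\<bar> + 1\<close>, so the terms are dominated
    by a geometric sequence of ratio \<open>r < 1\<close>, also for \<open>t = 0\<close>.\<close>
  define K where "K = (2 * \<bar>t\<bar> + 1) powr (1 / a)"
  have K: "0 < K" "K powr a = 2 * \<bar>t\<bar> + 1" using a by (auto simp: K_def powr_powr)
  define r where "r = \<bar>t\<bar> / (2 * \<bar>t\<bar> + 1)"
  have r: "0 \<le> r" "r < 1" by (auto simp: r_def)
  show ?thesis
  proof (rule Lim_null_comparison)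
    show "\<forall>\<^sub>F n in sequentially. norm (t ^ n / Gamma (1 + a * real n)) \<le> exp (K * exp 1) / K * r ^ n"
    proof (rule always_eventually, rule allI)
      fix n
      have z: "0 < 1 + a * real n" using a by (simp add: add_pos_nonneg)
      have "norm (t ^ n / Gamma (1 + a * real n)) = \<bar>t\<bar> ^ n / Gamma (1 + a * real n)"
        using Gamma_real_pos[OF z] by (simp add: power_abs)
      also have "\<dots> \<le> \<bar>t\<bar> ^ n / (K powr (1 + a * real n) * exp (- K * exp 1))"
        using Gamma_ge[OF z K(1)] Gamma_real_pos[OF z] K by (intro divide_left_mono) auto
      also have "K powr (1 + a * real n) = K * (2 * \<bar>t\<bar> + 1) ^ n"
        using K by (simp add: powr_add flip: powr_powr powr_realpow)
      also have "\<bar>t\<bar> ^ n / (K * (2 * \<bar>t\<bar> + 1) ^ n * exp (- K * exp 1)) = exp (K * exp 1) / K * r ^ n"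
        using K by (simp add: r_def power_divide exp_minus field_simps)
      finally show "norm (t ^ n / Gamma (1 + a * real n)) \<le> exp (K * exp 1) / K * r ^ n" .
    qed
    show "(\<lambda>n. exp (K * exp 1) / K * r ^ n) \<longlonglongrightarrow> 0"
      using tendsto_mult[OF tendsto_const LIMSEQ_realpow_zero[OF r], of "exp (K * exp 1) / K"] by simp
  qed
qed

section \<open>Moments of the stable variable\<close>

lemma ennreal_mult_eqD:
  assumes "ennreal x * e = ennreal y" "0 < x" "0 \<le> y"
  shows "e = ennreal (y / x)"
proof -
  have "ennreal x * e = ennreal x * ennreal (y / x)"
    using assms by (simp flip: ennreal_mult)
  then show ?thesis using assms(2) by (simp add: ennreal_mult_cancel_left)
qed

text \<open>\<open>Gamma (\<alpha> * n) * Z powr (- \<alpha> * n)\<close> is a Gamma integral of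
  \<open>exp (- Z * exp t)\<close>. Fubini brings in the Laplace transform of \<open>Z\<close>, and
  rescaling \<open>t\<close> by \<open>\<alpha>\<close> leaves
  \<open>Gamma n / \<alpha>\<close>.\<close>

lemma positive_stable_moments:
  fixes Z :: "'a \<Rightarrow> real" and n :: nat
  assumes M: "prob_space M" and \<alpha>: "0 < \<alpha>" and Z: "positive_stable M \<alpha> Z"
  shows "(\<integral>\<^sup>+\<omega>. ennreal ((Z \<omega> powr - \<alpha>) ^ n) \<partial>M) = ennreal (fact n / Gamma (1 + \<alpha> * real n))"
\<comment> \<open>For \<open>n = 0\<close> the Gamma integrals diverge.\<close>
proof (cases "n = 0")
  case True
  then show ?thesis using prob_space.emeasure_space_1[OF M] by simp
next
  case False
  interpret prob_space M by fact
  interpret pair_sigma_finite M lborel ..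
  have Zm[measurable]: "Z \<in> borel_measurable M" and Zpos: "AE \<omega> in M. 0 < Z \<omega>"
    using Z by (auto simp: positive_stable_def positive_rv_def)
  have n: "0 < real n" "0 < \<alpha> * real n" using False \<alpha> by auto
  have laplace: "(\<integral>\<^sup>+\<omega>. ennreal (exp (- l * Z \<omega>)) \<partial>M) = ennreal (exp (- (l powr \<alpha>)))" if "0 < l" for l
  proof -
    have "integrable M (\<lambda>\<omega>. exp (- l * Z \<omega>))"
    proof (rule integrable_const_bound[where B = 1])
      show "AE \<omega> in M. norm (exp (- l * Z \<omega>)) \<le> 1"
        using Zpos by eventually_elim (use that in simp)
    qed measurable
    then have "(\<integral>\<^sup>+\<omega>. ennreal (exp (- l * Z \<omega>)) \<partial>M) = ennreal (\<integral>\<omega>. exp (- l * Z \<omega>) \<partial>M)"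
      by (intro nn_integral_eq_integral) auto
    then show ?thesis using Z that by (simp add: positive_stable_def)
  qed
  have "ennreal (Gamma (\<alpha> * real n)) * (\<integral>\<^sup>+\<omega>. ennreal ((Z \<omega> powr - \<alpha>) ^ n) \<partial>M)
      = (\<integral>\<^sup>+\<omega>. ennreal (Gamma (\<alpha> * real n)) * ennreal ((Z \<omega> powr - \<alpha>) ^ n) \<partial>M)"
    by (rule nn_integral_cmult[symmetric]) measurable
  also have "\<dots> = (\<integral>\<^sup>+\<omega>. \<integral>\<^sup>+t. ennreal (exp (\<alpha> * real n * t) * exp (- Z \<omega> * exp t)) \<partial>lborel \<partial>M)"
  proof (rule nn_integral_cong_AE)
    show "AE \<omega> in M. ennreal (Gamma (\<alpha> * real n)) * ennreal ((Z \<omega> powr - \<alpha>) ^ n)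
        = (\<integral>\<^sup>+t. ennreal (exp (\<alpha> * real n * t) * exp (- Z \<omega> * exp t)) \<partial>lborel)"
      using Zpos
    proof eventually_elim
      case (elim \<omega>)
      have "(Z \<omega> powr - \<alpha>) ^ n = Z \<omega> powr - (\<alpha> * real n)"
        using elim by (simp add: powr_powr flip: powr_realpow)
      then show ?case
        unfolding nn_integral_Gamma_exp[OF n(2) elim]
        using Gamma_real_pos[OF n(2)] by (simp flip: ennreal_mult)
    qed
  qed
  also have "\<dots> = (\<integral>\<^sup>+t. \<integral>\<^sup>+\<omega>. ennreal (exp (\<alpha> * real n * t) * exp (- Z \<omega> * exp t)) \<partial>M \<partial>lborel)"
    by (rule Fubini'[symmetric]) measurable
  also have "\<dots> = (\<integral>\<^sup>+t. ennreal (exp (real n * (\<alpha> * t)) * exp (- 1 * exp (\<alpha> * t))) \<partial>lborel)"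
  proof (rule nn_integral_cong)
    fix t :: real
    have "(\<integral>\<^sup>+\<omega>. ennreal (exp (\<alpha> * real n * t) * exp (- Z \<omega> * exp t)) \<partial>M)
        = (\<integral>\<^sup>+\<omega>. ennreal (exp (\<alpha> * real n * t)) * ennreal (exp (- exp t * Z \<omega>)) \<partial>M)"
      by (intro nn_integral_cong) (simp add: mult.commute flip: ennreal_mult)
    also have "\<dots> = ennreal (exp (\<alpha> * real n * t)) * ennreal (exp (- (exp t powr \<alpha>)))"
      using laplace[of "exp t"] by (subst nn_integral_cmult) auto
    finally show "(\<integral>\<^sup>+\<omega>. ennreal (exp (\<alpha> * real n * t) * exp (- Z \<omega> * exp t)) \<partial>M)
        = ennreal (exp (real n * (\<alpha> * t)) * exp (- 1 * exp (\<alpha> * t)))"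
      by (simp add: exp_powr_real mult_ac flip: ennreal_mult)
  qed
  finally have 1: "ennreal (Gamma (\<alpha> * real n)) * (\<integral>\<^sup>+\<omega>. ennreal ((Z \<omega> powr - \<alpha>) ^ n) \<partial>M)
      = (\<integral>\<^sup>+t. ennreal (exp (real n * (\<alpha> * t)) * exp (- 1 * exp (\<alpha> * t))) \<partial>lborel)" .
  have "ennreal (Gamma (real n)) = (\<integral>\<^sup>+t. ennreal (exp (real n * t) * exp (- 1 * exp t)) \<partial>lborel)"
    using nn_integral_Gamma_exp[OF n(1), of 1] by simp
  also have "\<dots> = ennreal \<alpha> * (\<integral>\<^sup>+t. ennreal (exp (real n * (\<alpha> * t)) * exp (- 1 * exp (\<alpha> * t))) \<partial>lborel)"
    by (subst nn_integral_real_affine[where c = \<alpha> and t = 0]) (use \<alpha> in auto)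
  finally have "ennreal (\<alpha> * Gamma (\<alpha> * real n)) * (\<integral>\<^sup>+\<omega>. ennreal ((Z \<omega> powr - \<alpha>) ^ n) \<partial>M) = ennreal (Gamma (real n))"
    unfolding 1[symmetric] using \<alpha> Gamma_real_pos[OF n(2)] by (simp add: ennreal_mult mult.assoc)
  then have "(\<integral>\<^sup>+\<omega>. ennreal ((Z \<omega> powr - \<alpha>) ^ n) \<partial>M) = ennreal (Gamma (real n) / (\<alpha> * Gamma (\<alpha> * real n)))"
    using \<alpha> Gamma_real_pos[OF n(2)] Gamma_real_pos[OF n(1)] by (intro ennreal_mult_eqD) auto
  also have "Gamma (real n) / (\<alpha> * Gamma (\<alpha> * real n)) = fact n / Gamma (1 + \<alpha> * real n)"
  proof -
    have "Gamma (\<alpha> * real n + 1) = \<alpha> * real n * Gamma (\<alpha> * real n)"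
      by (rule Gamma_plus1) (use n in \<open>auto elim!: nonpos_Ints_cases\<close>)
    moreover have "fact n = real n * Gamma (real n)"
    proof -
      obtain k where "n = Suc k" using False by (cases n) auto
      then show ?thesis using Gamma_fact[of k, where 'a = real] by simp
    qed
    ultimately show ?thesis using n by (simp add: add.commute)
  qed
  finally show ?thesis .
qed

section \<open>Kanter's function and its derivatives\<close>

section \<open>Kanter's function\<close>

lemma DERIV_powr_log:
  assumes "(f has_real_derivative f') (at u)" "0 < f u"
  shows "((\<lambda>x. f x powr c) has_real_derivative f u powr c * (c * (f' / f u))) (at u)"
  using assms by (auto intro!: derivative_eq_intros simp: powr_diff)

text \<open>The stable index is \<open>a\<close> and \<open>b\<close> is its complement, so that
  \<open>a \<le> b\<close> expresses \<open>a \<le> 1 / 2\<close>.\<close>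

locale kanter =
  fixes a b :: real
  assumes a_pos: "0 < a" and a_le_b: "a \<le> b" and ab: "a + b = 1"
begin

lemma b_pos: "0 < b" and a_less_1: "a < 1" and b_less_1: "b < 1"
  using a_pos a_le_b ab by auto

lemma sin_ab_pos:
  assumes "0 < u" "u < pi"
  shows "0 < sin u" "0 < sin (a * u)" "0 < sin (b * u)"
proof -
  have "a * u < 1 * pi" "b * u < 1 * pi"
    using assms a_less_1 b_less_1 a_pos b_pos by (intro mult_strict_mono; simp)+
  then show "0 < sin u" "0 < sin (a * u)" "0 < sin (b * u)"
    using assms a_pos b_pos by (auto intro!: sin_gt_zero)
qed

lemma sin_cos_add:
  "sin u = sin (a * u) * cos (b * u) + cos (a * u) * sin (b * u)"
  "cos u = cos (a * u) * cos (b * u) - sin (a * u) * sin (b * u)"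
proof -
  have "u = a * u + b * u" using ab by (simp flip: distrib_right)
  then show "sin u = sin (a * u) * cos (b * u) + cos (a * u) * sin (b * u)"
    "cos u = cos (a * u) * cos (b * u) - sin (a * u) * sin (b * u)"
    by (metis sin_add, metis cos_add)
qed

text \<open>With \<open>\<alpha> = a\<close> and \<open>\<beta> = b = 1 - \<alpha>\<close>, \<open>A\<close> is the function in Kanter's factorization
  \<open>Z powr (- a / b) = L / A U\<close>, where \<open>L\<close> is exponential, \<open>U\<close> is uniform on \<open>(0, \<pi>)\<close> and both are independent.
  The function \<open>m\<close> turns out to be an antiderivative of \<open>A\<close>, and \<open>phi = m A' / A\<^sup>2\<close> is the derivative of
  \<open>ln A\<close> with respect to \<open>ln m\<close>; it equals \<open>\<bar>a - b * rho u * cis u\<bar>\<^sup>2 / a\<close>.\<close>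

definition A :: "real \<Rightarrow> real" where
  "A u = sin (a * u) powr (a / b) * sin (b * u) * sin u powr (- (1 / b))"

definition m :: "real \<Rightarrow> real" where
  "m u = b / a * sin (a * u) powr (1 / b) * sin u powr (- (a / b))"

text \<open>The polar radius, at angle \<open>u\<close>, of the curve along which
  \<open>z powr (- a) * (1 + z)\<close> is real.\<close>

definition rho :: "real \<Rightarrow> real" where
  "rho u = sin (a * u) / sin (b * u)"

definition phi :: "real \<Rightarrow> real" where
  "phi u = ((b * rho u - a)\<^sup>2 + 2 * a * b * rho u * (1 - cos u)) / a"

text \<open>This squared modulus is what differentiating \<open>A\<close> produces, whereas the
  definition of \<open>phi\<close> displays its sign and monotonicity.\<close>

lemma phi_times_a: "phi u * a = a\<^sup>2 + b\<^sup>2 * (rho u)\<^sup>2 - 2 * a * b * rho u * cos u"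
proof -
  have "phi u * a = (b * rho u - a)\<^sup>2 + 2 * a * b * rho u * (1 - cos u)"
    using a_pos by (simp add: phi_def)
  then show ?thesis by (simp add: power2_eq_square algebra_simps)
qed

lemma A_pos: "0 < u \<Longrightarrow> u < pi \<Longrightarrow> 0 < A u"
  using sin_ab_pos[of u] by (simp add: A_def)

lemma m_pos: "0 < u \<Longrightarrow> u < pi \<Longrightarrow> 0 < m u"
  using sin_ab_pos[of u] a_pos b_pos by (simp add: m_def)

lemma rho_pos: "0 < u \<Longrightarrow> u < pi \<Longrightarrow> 0 < rho u"
  using sin_ab_pos[of u] by (simp add: rho_def)

lemma exponents: "1 / b = 1 + a / b"
  using ab b_pos by (simp add: field_simps)

lemma m_eq_A:
  assumes "0 < u" "u < pi"
  shows "m u = b / a * rho u * sin u * A u"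
proof -
  note s = sin_ab_pos[OF assms]
  have "sin (a * u) powr (1 / b) = sin (a * u) * sin (a * u) powr (a / b)"
    unfolding exponents using s by (simp add: powr_add)
  moreover have "sin u powr (- (a / b)) = sin u * sin u powr (- (1 / b))"
  proof -
    have "- (a / b) = 1 + - (1 / b)" using exponents by simp
    then show ?thesis using s by (simp only: powr_add powr_one)
  qed
  ultimately show ?thesis
    using s by (simp add: m_def A_def rho_def)
qed

text \<open>The logarithmic derivative of \<open>m\<close> is \<open>a / b\<close> times
  \<open>cot (a * u) - cot u\<close>, which simplifies because
  \<open>u - a * u = b * u\<close>.\<close>

lemma DERIV_m:
  assumes "0 < u" "u < pi"
  shows "(m has_real_derivative A u) (at u)"
proof -
  note s = sin_ab_pos[OF assms]
  have "(m has_real_derivative m u * (a / b * (cos (a * u) / sin (a * u) - cos u / sin u))) (at u)"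
    unfolding m_def
    by (rule derivative_eq_intros DERIV_powr_log refl s)+ (use a_pos b_pos in \<open>simp add: algebra_simps\<close>)
  also have "cos (a * u) / sin (a * u) - cos u / sin u = sin (b * u) / (sin (a * u) * sin u)"
  proof -
    have "sin u * cos (a * u) - cos u * sin (a * u) = sin (u - a * u)" by (simp add: sin_diff)
    also have "u - a * u = (1 - a) * u" by (simp add: left_diff_distrib)
    also have "1 - a = b" using ab by simp
    finally show ?thesis using s by (simp add: field_simps)
  qed
  also have "m u * (a / b * (sin (b * u) / (sin (a * u) * sin u))) = A u"
    using s a_pos b_pos by (simp add: m_eq_A[OF assms] rho_def)
  finally show ?thesis .
qed

text \<open>The logarithmic derivative \<open>?L\<close> is a combination of three cotangents.
  Multiplied by \<open>b * sin u\<close> it becomes \<open>phi u * a / rho u\<close>, through the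
  addition formulas for \<open>u = a * u + b * u\<close>.\<close>

lemma DERIV_A:
  assumes "0 < u" "u < pi"
  shows "(A has_real_derivative phi u * (A u)\<^sup>2 / m u) (at u)"
proof -
  note s = sin_ab_pos[OF assms]
  let ?L = "a\<^sup>2 / b * (cos (a * u) / sin (a * u)) + b * (cos (b * u) / sin (b * u)) - 1 / b * (cos u / sin u)"
  have "(A has_real_derivative A u * ?L) (at u)"
    unfolding A_def
    by (rule derivative_eq_intros DERIV_powr_log refl s)+
      (use s a_pos b_pos in \<open>simp add: field_simps power2_eq_square\<close>)
  also have "?L = phi u * A u / m u"
  proof -
    define p q P Q where pq: "p = sin (a * u)" "q = sin (b * u)" "P = cos (a * u)" "Q = cos (b * u)"
    have pq1: "P\<^sup>2 + p\<^sup>2 = 1" "Q\<^sup>2 + q\<^sup>2 = 1" by (auto simp: pq)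
    have su: "sin u = p * Q + P * q" and cu: "cos u = P * Q - p * q"
      using sin_cos_add[of u] by (auto simp: pq)
    have pos: "0 < p" "0 < q" "0 < p * Q + P * q" using s by (auto simp: pq su)
    have "?L * b * sin u = a\<^sup>2 * (sin u * P / p) + b\<^sup>2 * (sin u * Q / q) - cos u"
      using s b_pos by (simp add: field_simps power2_eq_square flip: pq)
    also have "sin u * P / p = cos u + q / p"
    proof -
      have "sin u * P = cos u * p + q * (P\<^sup>2 + p\<^sup>2)"
        by (simp add: su cu power2_eq_square algebra_simps)
      then show ?thesis using pos pq1 by (simp add: field_simps)
    qed
    also have "sin u * Q / q = cos u + p / q"
    proof -
      have "sin u * Q = cos u * q + p * (Q\<^sup>2 + q\<^sup>2)"
        by (simp add: su cu power2_eq_square algebra_simps)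
      then show ?thesis using pos pq1 by (simp add: field_simps)
    qed
    \<comment> \<open>Writing 1 as \<open>(a + b)\<^sup>2\<close> leaves the coefficient
      \<open>- 2 * a * b\<close> of \<open>cos u\<close>.\<close>
    also have "a\<^sup>2 * (cos u + q / p) + b\<^sup>2 * (cos u + p / q) - cos u
        = a\<^sup>2 * (q / p) + b\<^sup>2 * (p / q) + (a\<^sup>2 + b\<^sup>2 - (a + b)\<^sup>2) * cos u"
      by (simp add: ab algebra_simps)
    also have "\<dots> = (a\<^sup>2 + b\<^sup>2 * (p / q)\<^sup>2 - 2 * a * b * (p / q) * cos u) / (p / q)"
      using pos by (simp add: field_simps power2_eq_square)
    also have "\<dots> = phi u * a / rho u"
      by (simp only: phi_times_a rho_def pq)
    finally have "?L * (b * sin u) = phi u * a / rho u"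
      by (simp only: mult.assoc)
    then have "?L = phi u * a / rho u / (b * sin u)"
      by (rule iffD2[OF nonzero_eq_divide_eq, rotated]) (use s b_pos in simp)
    also have "\<dots> = phi u * A u / m u"
      using s a_pos b_pos A_pos[OF assms] rho_pos[OF assms] by (simp add: m_eq_A[OF assms])
    finally show ?thesis .
  qed
  finally show ?thesis by (simp add: power2_eq_square mult_ac)
qed

section \<open>Monotonicity of \<open>rho\<close>, \<open>phi\<close> and \<open>A\<close>\<close>

lemma cos_scale_le:
  assumes "0 \<le> u" "u \<le> pi"
  shows "cos (b * u) \<le> cos (a * u)" "cos u \<le> cos ((b - a) * u)"
proof -
  have "a * u \<le> b * u" "(b - a) * u \<le> u"
    using assms a_le_b ab a_pos by (auto intro!: mult_right_mono mult_left_le_one_le)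
  moreover have "b * u \<le> pi" using b_less_1 b_pos assms by (meson less_imp_le mult_left_le_one_le order.trans)
  ultimately show "cos (b * u) \<le> cos (a * u)" "cos u \<le> cos ((b - a) * u)"
    using assms a_pos a_le_b by (auto intro!: cos_monotone_0_pi_le)
qed

text \<open>The difference \<open>b * sin (a * u) - a * sin (b * u)\<close> vanishes at 0 and has a
  nonnegative derivative. The bound makes \<open>(b * rho u - a)\<^sup>2\<close> increase with
  \<open>rho u\<close>.\<close>

lemma rho_ge: 
  assumes "0 < u" "u < pi"
  shows "a \<le> b * rho u"
proof -
  let ?g = "\<lambda>u. b * sin (a * u) - a * sin (b * u)"
  have "?g 0 \<le> ?g u"
  proof (rule DERIV_nonneg_imp_nondecreasing[where f = ?g])
    fix x assume "0 \<le> x" "x \<le> u"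
    then have "0 \<le> a * b * (cos (a * x) - cos (b * x))"
      using cos_scale_le(1)[of x] assms a_pos b_pos by simp
    moreover have "(?g has_real_derivative a * b * (cos (a * x) - cos (b * x))) (at x)"
      by (auto intro!: derivative_eq_intros simp: algebra_simps)
    ultimately show "\<exists>y. (?g has_real_derivative y) (at x) \<and> 0 \<le> y" by blast
  qed (use assms in simp)
  then show ?thesis using sin_ab_pos[OF assms] by (simp add: rho_def field_simps)
qed

text \<open>By the sum-to-product formula, \<open>sin (b * u) - sin (a * u)\<close> is a product of
  nonnegative factors, one of them \<open>cos (u / 2)\<close>.\<close>

lemma rho_le_1:
  assumes "0 < u" "u < pi"
  shows "rho u \<le> 1"
proof -
  have "sin (b * u) - sin (a * u) = 2 * sin ((b * u - a * u) / 2) * cos ((b * u + a * u) / 2)"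
    by (rule sin_diff_sin)
  also have "b * u + a * u = u" using ab by (metis add.commute distrib_right mult_1)
  also have "0 \<le> 2 * sin ((b * u - a * u) / 2) * cos (u / 2)"
  proof (intro mult_nonneg_nonneg sin_ge_zero cos_ge_zero)
    have "b * u \<le> u" "a * u \<le> b * u" "0 \<le> a * u"
      using assms b_less_1 b_pos a_le_b a_pos by (auto intro: mult_right_mono)
    then have "0 \<le> (b * u - a * u) / 2 \<and> (b * u - a * u) / 2 \<le> pi" using assms by (simp, linarith)
    then show "0 \<le> (b * u - a * u) / 2" "(b * u - a * u) / 2 \<le> pi" by blast+
  qed (use assms in auto)
  finally show ?thesis using sin_ab_pos[OF assms] by (simp add: rho_def)
qed

lemma DERIV_rho:
  assumes "0 < u" "u < pi"
  shows "(rho has_real_derivative rho u * (a * (cos (a * u) / sin (a * u)) - b * (cos (b * u) / sin (b * u)))) (at u)"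
  unfolding rho_def using sin_ab_pos[OF assms]
  by (auto intro!: derivative_eq_intros simp: field_simps)

text \<open>The logarithmic derivative of \<open>rho\<close> has the sign of
  \<open>sin ((b - a) * u) - (b - a) * sin u\<close>, which vanishes at 0 and is
  nondecreasing.\<close>

lemma rho_mono:
  assumes "0 < u" "u \<le> v" "v < pi"
  shows "rho u \<le> rho v"
proof (rule DERIV_nonneg_imp_nondecreasing[OF \<open>u \<le> v\<close>])
  fix x assume x: "u \<le> x" "x \<le> v"
  then have x': "0 < x" "x < pi" using assms by auto
  note s = sin_ab_pos[OF x']
  let ?g = "\<lambda>x. sin ((b - a) * x) - (b - a) * sin x"
  have "?g 0 \<le> ?g x"
  proof (rule DERIV_nonneg_imp_nondecreasing[where f = ?g])
    fix y assume "0 \<le> y" "y \<le> x"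
    then have "0 \<le> (b - a) * (cos ((b - a) * y) - cos y)"
      using cos_scale_le(2)[of y] x' a_le_b by simp
    moreover have "(?g has_real_derivative (b - a) * (cos ((b - a) * y) - cos y)) (at y)"
      by (auto intro!: derivative_eq_intros simp: algebra_simps)
    ultimately show "\<exists>z. (?g has_real_derivative z) (at y) \<and> 0 \<le> z" by blast
  qed (use x' in simp)
  then have "0 \<le> sin (b * x - a * x) - (b - a) * sin x" by (simp add: left_diff_distrib)
  also have "\<dots> = (a + b) * sin (b * x - a * x) - (b - a) * sin x" by (simp add: ab)
  also have "\<dots> = 2 * (a * cos (a * x) * sin (b * x) - b * cos (b * x) * sin (a * x))"
    unfolding sin_cos_add(1)[of x] sin_diff by (simp add: algebra_simps)
  finally have "0 \<le> a * (cos (a * x) / sin (a * x)) - b * (cos (b * x) / sin (b * x))"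
    using s by (simp add: field_simps)
  then show "\<exists>y. (rho has_real_derivative y) (at x) \<and> 0 \<le> y"
    using DERIV_rho[OF x'] rho_pos[OF x'] by (meson less_imp_le mult_nonneg_nonneg)
qed

lemma phi_nonneg: "0 < u \<Longrightarrow> u < pi \<Longrightarrow> 0 \<le> phi u"
  using rho_pos[of u] a_pos b_pos by (auto simp: phi_def intro!: divide_nonneg_pos add_nonneg_nonneg)

text \<open>Triangle inequality: \<open>a - b * rho u * cis u\<close> has modulus at most
  \<open>a + b = 1\<close>.\<close>

lemma phi_le: 
  assumes "0 < u" "u < pi"
  shows "phi u \<le> 1 / a"
proof -
  have "(b * rho u - a)\<^sup>2 + 2 * a * b * rho u * (1 - cos u) \<le> (b * rho u - a)\<^sup>2 + 2 * a * b * rho u * 2"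
    using rho_pos[OF assms] a_pos b_pos cos_ge_minus_one[of u]
    by (intro add_left_mono mult_left_mono) auto
  also have "\<dots> = (a + b * rho u)\<^sup>2" by (simp add: power2_eq_square algebra_simps)
  also have "\<dots> \<le> (a + b * 1)\<^sup>2"
    using rho_pos[OF assms] rho_le_1[OF assms] a_pos b_pos
    by (intro power_mono add_left_mono mult_left_mono) auto
  finally show ?thesis using a_pos by (simp add: phi_def ab divide_right_mono)
qed

text \<open>Both summands in \<open>phi\<close> increase, because \<open>rho\<close> and
  \<open>- cos\<close> do and \<open>b * rho u\<close> stays above \<open>a\<close>.\<close>

lemma phi_mono:
  assumes "0 < u" "u \<le> v" "v < pi"
  shows "phi u \<le> phi v"
proof -
  have r: "rho u \<le> rho v" by (rule rho_mono) fact+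
  have "cos v \<le> cos u" using assms by (intro cos_monotone_0_pi_le) auto
  moreover have "0 < rho u" using assms by (intro rho_pos) auto
  moreover have "a \<le> b * rho u" using assms by (intro rho_ge) auto
  moreover have "b * rho u \<le> b * rho v" using r b_pos by simp
  ultimately show ?thesis
    unfolding phi_def using a_pos b_pos r
    by (intro divide_right_mono add_mono power_mono mult_mono) auto
qed

lemma A_mono:
  assumes "0 < u" "u \<le> v" "v < pi"
  shows "A u \<le> A v"
proof (rule DERIV_nonneg_imp_nondecreasing[OF \<open>u \<le> v\<close>])
  fix x assume x: "u \<le> x" "x \<le> v"
  then have x': "0 < x" "x < pi" using assms by auto
  show "\<exists>y. (A has_real_derivative y) (at x) \<and> 0 \<le> y"
    using DERIV_A[OF x'] phi_nonneg[OF x'] m_pos[OF x'] by (metis divide_nonneg_pos mult_nonneg_nonneg zero_le_power2)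
qed

text \<open>With \<open>rho u \<le> 1\<close>, the factor \<open>sin u\<close> survives; it makes
  the boundary terms vanish in the integration by parts.\<close>

lemma m_le:
  assumes "0 < u" "u < pi"
  shows "m u \<le> b / a * sin u * A u"
proof -
  have "rho u * (b / a * sin u * A u) \<le> 1 * (b / a * sin u * A u)"
    using rho_le_1[OF assms] A_pos[OF assms] a_pos b_pos sin_ab_pos(1)[OF assms]
    by (intro mult_right_mono) auto
  then show ?thesis by (simp add: m_eq_A[OF assms] mult_ac)
qed


section \<open>Integrals of powers of \<open>A\<close>\<close>

lemma tendsto_rho:
  "(rho \<longlongrightarrow> a / b) (at_right 0)" "(rho \<longlongrightarrow> 1) (at_left pi)"
proof -
  show "(rho \<longlongrightarrow> a / b) (at_right 0)"
    unfolding rho_def using a_pos b_pos by (real_asymp simp: divide_inverse)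
  have pos: "0 < sin (b * pi)"
    using b_pos b_less_1 by (intro sin_gt_zero) auto
  have eq: "sin (a * pi) = sin (b * pi)"
  proof -
    have "a * pi = pi - b * pi" using ab by (simp add: algebra_simps flip: distrib_left)
    then show ?thesis by simp
  qed
  have "(rho \<longlongrightarrow> sin (a * pi) / sin (b * pi)) (at_left pi)"
    unfolding rho_def using pos by (intro tendsto_intros) auto
  then show "(rho \<longlongrightarrow> 1) (at_left pi)" using pos eq by simp
qed

text \<open>The right-hand side is the modulus of \<open>z powr (- a * n) * (1 + z) ^ n\<close> at
  \<open>z = rho u * cis u\<close>. Taking logarithms and using \<open>b = 1 - a\<close> gives the
  equality.\<close>

lemma A_powr_eq:
  assumes "0 < u" "u < pi"
  shows "A u powr (- b * real n) = (sin u / sin (b * u)) ^ n * rho u powr (- (a * real n))"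
proof -
  note s = sin_ab_pos[OF assms]
  have "ln (A u) * (- b * real n) = real n * (ln (sin u) - b * ln (sin (b * u)) - a * ln (sin (a * u)))"
    using s b_pos by (simp add: A_def ln_mult ln_powr field_simps)
  also have "\<dots> = real n * (ln (sin u) - ln (sin (b * u))) + (- (a * real n)) * ln (rho u)"
  proof -
    have *: "b * ln (sin (b * u)) = ln (sin (b * u)) - a * ln (sin (b * u))"
      using ab by (metis add_diff_cancel_left' left_diff_distrib mult_1)
    show ?thesis unfolding * using s by (simp add: rho_def ln_div algebra_simps)
  qed
  also have "real n * (ln (sin u) - ln (sin (b * u))) = ln ((sin u / sin (b * u)) ^ n)"
    using s by (simp add: ln_realpow ln_div)
  finally show ?thesis
    using s A_pos[OF assms] rho_pos[OF assms] by (simp add: powr_def exp_diff exp_minus divide_inverse mult.commute)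
qed

text \<open>This is the law of sines in the triangle 0, 1, \<open>1 + z\<close> with
  \<open>z = rho u * cis u\<close>, whose angles are \<open>a * u\<close> at 0,
  \<open>pi - u\<close> at 1 and \<open>b * u\<close> at \<open>1 + z\<close>.\<close>

lemma one_plus_rho_cis:
  assumes "0 < u" "u < pi"
  shows "1 + complex_of_real (rho u) * cis u = complex_of_real (sin u / sin (b * u)) * cis (a * u)"
proof -
  note s = sin_ab_pos[OF assms]
  have b: "b * u = u - a * u" using ab by (metis add_diff_cancel_left' left_diff_distrib mult_1)
  have "sin (b * u) + sin (a * u) * cos u = sin u * cos (a * u)"
    unfolding b sin_diff by (simp add: algebra_simps)
  then show ?thesis
    using s by (auto simp: complex_eq_iff rho_def field_simps)
qed

text \<open>The complex power \<open>z powr (- a * n) * (1 + z) ^ n\<close> is real along the curve \<open>z = rho u * cis u\<close>,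
  and expanding \<open>(1 + z) ^ n\<close> gives an antiderivative of its values with respect to \<open>u\<close>.\<close>

lemma sum_binomial_rho:
  fixes n :: nat
  assumes "0 < u" "u < pi"
  defines "e \<equiv> \<lambda>k. real k - a * real n"
  shows "(\<Sum>k\<le>n. real (n choose k) * (rho u powr e k * cos (e k * u))) = A u powr (- b * real n)"
    and "(\<Sum>k\<le>n. real (n choose k) * (rho u powr e k * sin (e k * u))) = 0"
proof -
  note r = rho_pos[OF assms(1,2)]
  \<comment> \<open>\<open>w\<close> is \<open>z powr (- a * n)\<close> on the branch where
    \<open>z = rho u * cis u\<close> has argument \<open>u\<close>.\<close>
  define w where "w = complex_of_real (rho u powr (- (a * real n))) * cis (- (a * real n * u))"
  have "(\<Sum>k\<le>n. of_nat (n choose k) * (complex_of_real (rho u powr e k) * cis (e k * u)))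
      = (\<Sum>k\<le>n. of_nat (n choose k) * (of_real (rho u) * cis u) ^ k * 1 ^ (n - k)) * w"
    unfolding sum_distrib_right
  proof (intro sum.cong refl)
    fix k
    have "rho u powr e k = rho u ^ k * rho u powr (- (a * real n))"
      using r by (simp add: e_def powr_diff powr_minus powr_realpow divide_inverse)
    moreover have "cis (e k * u) = cis u ^ k * cis (- (a * real n * u))"
    proof -
      have "cis (e k * u) = cis (real k * u + - (a * real n * u))"
        by (simp add: e_def algebra_simps)
      then show ?thesis by (simp only: Complex.DeMoivre cis_mult[symmetric])
    qed
    ultimately show "of_nat (n choose k) * (complex_of_real (rho u powr e k) * cis (e k * u)) =
        of_nat (n choose k) * (of_real (rho u) * cis u) ^ k * 1 ^ (n - k) * w"
      by (simp add: w_def power_mult_distrib mult_ac)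
  qed
  also have "\<dots> = (of_real (rho u) * cis u + 1) ^ n * w"
    by (simp only: binomial_ring)
  also have "of_real (rho u) * cis u + 1 = complex_of_real (sin u / sin (b * u)) * cis (a * u)"
    using one_plus_rho_cis[OF assms(1,2)] by (simp add: add.commute)
  also have "\<dots> ^ n * w = complex_of_real ((sin u / sin (b * u)) ^ n * rho u powr (- (a * real n)))
      * (cis (a * u) ^ n * cis (- (a * real n * u)))"
    by (simp only: w_def power_mult_distrib of_real_mult of_real_power mult_ac)
  \<comment> \<open>The phases cancel because \<open>1 + z\<close> has argument
    \<open>a * u\<close>; hence the whole sum is real.\<close>
  also have "cis (a * u) ^ n * cis (- (a * real n * u)) = 1"
    unfolding Complex.DeMoivre cis_mult by (simp add: algebra_simps)
  also have "complex_of_real ((sin u / sin (b * u)) ^ n * rho u powr (- (a * real n))) * 1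
      = of_real (A u powr (- b * real n))"
    by (simp only: A_powr_eq[OF assms(1,2)] mult_1_right)
  finally have *: "(\<Sum>k\<le>n. of_nat (n choose k) * (complex_of_real (rho u powr e k) * cis (e k * u)))
      = of_real (A u powr (- b * real n))" .
  show "(\<Sum>k\<le>n. real (n choose k) * (rho u powr e k * cos (e k * u))) = A u powr (- b * real n)"
    using arg_cong[OF *, of Re] by simp
  show "(\<Sum>k\<le>n. real (n choose k) * (rho u powr e k * sin (e k * u))) = 0"
    using arg_cong[OF *, of Im] by simp
qed

text \<open>The antiderivative \<open>G\<close> sums the imaginary parts of
  \<open>z powr (e k) / e k\<close> along the curve. In its derivative the sine sum, multiplied by
  \<open>rho' / rho\<close>, vanishes, and the cosine sum is the integrand.\<close>

lemma A_powr_integral: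
  fixes n :: nat
  shows "set_integrable lborel {0<..<pi} (\<lambda>u. A u powr (- b * real n))"
    and "(LBINT u:{0<..<pi}. A u powr (- b * real n))
      = pi * (fact n * rGamma (1 + a * real n) * rGamma (1 + b * real n))"
proof -
  define e where "e = (\<lambda>k. real k - a * real n)"
  \<comment> \<open>If \<open>a * n\<close> is an integer, some \<open>e k\<close> may be 0; the
    term is then \<open>u\<close>, the limit of \<open>sin (e * u) / e\<close> as \<open>e\<close>
    tends to 0.\<close>
  define T where "T = (\<lambda>k u. if e k = 0 then u else rho u powr e k * sin (e k * u) / e k)"
  define G where "G = (\<lambda>u. \<Sum>k\<le>n. real (n choose k) * T k u)"
  have DT: "(T k has_real_derivative
      rho u powr e k * sin (e k * u) * (a * (cos (a * u) / sin (a * u)) - b * (cos (b * u) / sin (b * u)))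
      + rho u powr e k * cos (e k * u)) (at u)"
    if u: "0 < u" "u < pi" for u k
  proof (cases "e k = 0")
    case True
    then show ?thesis using rho_pos[OF u] by (simp add: T_def)
  next
    case False
    have "((\<lambda>u. rho u powr e k * sin (e k * u) / e k) has_real_derivative
      rho u powr e k * sin (e k * u) * (a * (cos (a * u) / sin (a * u)) - b * (cos (b * u) / sin (b * u)))
      + rho u powr e k * cos (e k * u)) (at u)"
    proof -
      let ?l = "a * (cos (a * u) / sin (a * u)) - b * (cos (b * u) / sin (b * u))"
      have "((\<lambda>u. sin (e k * u)) has_real_derivative cos (e k * u) * e k) (at u)"
        by (auto intro!: derivative_eq_intros)
      then have "((\<lambda>u. rho u powr e k * sin (e k * u) / e k) has_real_derivative
        (rho u powr e k * (e k * (rho u * ?l / rho u)) * sin (e k * u)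
          + cos (e k * u) * e k * rho u powr e k) / e k) (at u)"
        by (intro DERIV_cdivide DERIV_mult DERIV_powr_log DERIV_rho u rho_pos)
      then show ?thesis
        using rho_pos[OF u] False by (simp add: add_divide_distrib mult_ac)
    qed
    then show ?thesis using False by (simp add: T_def)
  qed
  have DG: "(G has_real_derivative A u powr (- b * real n)) (at u)" if u: "0 < u" "u < pi" for u
  proof -
    let ?l = "a * (cos (a * u) / sin (a * u)) - b * (cos (b * u) / sin (b * u))"
    have "(G has_real_derivative (\<Sum>k\<le>n. real (n choose k) *
        (rho u powr e k * sin (e k * u) * ?l + rho u powr e k * cos (e k * u)))) (at u)"
      unfolding G_def by (intro DERIV_sum DERIV_cmult DT u)
    also have "(\<Sum>k\<le>n. real (n choose k) * (rho u powr e k * sin (e k * u) * ?l + rho u powr e k * cos (e k * u)))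
        = (\<Sum>k\<le>n. real (n choose k) * (rho u powr e k * sin (e k * u))) * ?l
          + (\<Sum>k\<le>n. real (n choose k) * (rho u powr e k * cos (e k * u)))"
      by (simp only: sum_distrib_right sum.distrib[symmetric] distrib_left mult.assoc)
    also have "\<dots> = A u powr (- b * real n)"
      unfolding e_def sum_binomial_rho[OF u] by simp
    finally show ?thesis .
  qed
  have cont: "isCont (\<lambda>u. A u powr (- b * real n)) u" if "0 < u" "u < pi" for u
    using DERIV_isCont[OF DERIV_A[OF that]] A_pos[OF that] by (intro continuous_intros) auto
  have "(T k \<longlongrightarrow> 0) (at_right 0)" for k
  proof (cases "e k = 0")
    case False
    have "((\<lambda>u. rho u powr e k * sin (e k * u) / e k) \<longlongrightarrow> (a / b) powr e k * sin (e k * 0) / e k) (at_right 0)"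
      using a_pos b_pos False by (intro tendsto_intros tendsto_rho) auto
    then show ?thesis using False by (simp add: T_def)
  qed (simp add: T_def tendsto_ident_at)
  then have "(G \<longlongrightarrow> (\<Sum>k\<le>n. real (n choose k) * 0)) (at_right 0)"
    unfolding G_def by (intro tendsto_intros)
  then have G0: "(G \<longlongrightarrow> 0) (at_right 0)" by simp
  \<comment> \<open>Since \<open>rho\<close> tends to 1 at \<open>pi\<close>, only the value of
    \<open>sinc\<close> remains, and \<open>binomial_sinc_sum\<close> evaluates the total.\<close>
  have "(T k \<longlongrightarrow> pi * sinc (pi * e k)) (at_left pi)" for k
  proof (cases "e k = 0")
    case False
    have "((\<lambda>u. rho u powr e k * sin (e k * u) / e k) \<longlongrightarrow> 1 powr e k * sin (e k * pi) / e k) (at_left pi)"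
      using False by (intro tendsto_intros tendsto_rho) auto
    then show ?thesis using False by (simp add: T_def mult.commute)
  qed (simp add: T_def tendsto_ident_at)
  then have "(G \<longlongrightarrow> (\<Sum>k\<le>n. real (n choose k) * (pi * sinc (pi * e k)))) (at_left pi)"
    unfolding G_def by (intro tendsto_intros)
  also have "(\<Sum>k\<le>n. real (n choose k) * (pi * sinc (pi * e k)))
      = pi * (\<Sum>k\<le>n. real (n choose k) * sinc (pi * (real k - a * real n)))"
    unfolding sum_distrib_left e_def by (intro sum.cong) auto
  also have "\<dots> = pi * (fact n * rGamma (1 + a * real n) * rGamma (1 + real n - a * real n))"
    by (simp only: binomial_sinc_sum)
  also have "1 + real n - a * real n = 1 + b * real n"
    using ab by (metis add.assoc add_diff_cancel_left' diff_add_eq distrib_right mult_1 add_diff_eq)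
  finally have Gpi: "(G \<longlongrightarrow> pi * (fact n * rGamma (1 + a * real n) * rGamma (1 + b * real n))) (at_left pi)" .
  \<comment> \<open>For a nonnegative integrand the fundamental theorem also yields integrability up
    to both endpoints.\<close>
  note FTC = interval_integral_FTC_nonneg[of "ereal 0" "ereal pi" G "\<lambda>u. A u powr (- b * real n)"
      0 "pi * (fact n * rGamma (1 + a * real n) * rGamma (1 + b * real n))"]
  have lims: "((G \<circ> real_of_ereal) \<longlongrightarrow> 0) (at_right (ereal 0))"
    "((G \<circ> real_of_ereal) \<longlongrightarrow> pi * (fact n * rGamma (1 + a * real n) * rGamma (1 + b * real n))) (at_left (ereal pi))"
    using G0 Gpi unfolding ereal_tendsto_simps by simp_all
  show "set_integrable lborel {0<..<pi} (\<lambda>u. A u powr (- b * real n))"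
    using FTC(1)[OF _ _ _ _ lims] DG cont by simp
  show "(LBINT u:{0<..<pi}. A u powr (- b * real n))
      = pi * (fact n * rGamma (1 + a * real n) * rGamma (1 + b * real n))"
    using FTC(2)[OF _ _ _ _ lims] DG cont by (simp add: interval_integral_Ioo)
qed

end

section \<open>Exponential bounds for differentiation under the integral\<close>

section \<open>Log-concavity of the density\<close>

text \<open>Raise \<open>x \<le> exp x\<close>, at \<open>x = s * z / k\<close>, to the power
  \<open>k\<close>.\<close>

lemma power_mult_exp_le:
  fixes s z :: real
  assumes "0 < s" "0 \<le> z"
  shows "z ^ k * exp (- s * z) \<le> (real k / s) ^ k"
proof (cases "k = 0")
  case False
  have "s * z / real k \<le> exp (s * z / real k)"
    using exp_ge_add_one_self[of "s * z / real k"] by linarith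
  then have "z \<le> real k / s * exp (s * z / real k)"
    using assms False by (simp add: field_simps)
  then have "z ^ k \<le> (real k / s * exp (s * z / real k)) ^ k"
    using assms by (intro power_mono)
  also have "\<dots> = (real k / s) ^ k * exp (s * z)"
    by (simp only: power_mult_distrib exp_of_nat_mult[symmetric]) (use False in simp)
  finally show ?thesis by (simp add: exp_minus field_simps)
qed (use assms in simp)

text \<open>By convexity, the tangent at \<open>s\<close> bounds the remainder below by 0 and the
  tangent at \<open>t\<close> bounds it above by \<open>(t - s) * z\<close> times a difference of
  exponentials, which is again estimated by a tangent.\<close>

lemma exp_taylor_bound:
  fixes z s0 s t :: real
  assumes "0 \<le> z" "s0 \<le> s" "s0 \<le> t"
  shows "\<bar>exp (- t * z) - exp (- s * z) + (t - s) * (z * exp (- s * z))\<bar> \<le> (t - s)\<^sup>2 * (z\<^sup>2 * exp (- s0 * z))"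
proof -
  have tangent: "exp (- x * z) * (1 - (y - x) * z) \<le> exp (- y * z)" for x y
  proof -
    have "exp (- x * z) * (1 - (y - x) * z) \<le> exp (- x * z) * exp (- ((y - x) * z))"
      using exp_ge_add_one_self[of "- ((y - x) * z)"] by simp
    also have "\<dots> = exp (- y * z)" by (simp add: algebra_simps flip: exp_add)
    finally show ?thesis .
  qed
  have less: "exp (- x * z) - exp (- y * z) \<le> \<bar>y - x\<bar> * (z * exp (- s0 * z))" if "s0 \<le> x" for x y
  proof -
    have "exp (- x * z) - exp (- y * z) \<le> (y - x) * (z * exp (- x * z))"
      using tangent[of x y] by (simp add: algebra_simps)
    also have "\<dots> \<le> \<bar>y - x\<bar> * (z * exp (- s0 * z))"
      using assms that by (intro mult_mono) (auto intro!: mult_left_mono mult_right_mono)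
    finally show ?thesis .
  qed
  let ?D = "exp (- t * z) - exp (- s * z) + (t - s) * (z * exp (- s * z))"
  have "0 \<le> ?D" using tangent[of s t] by (simp add: algebra_simps)
  moreover have "?D \<le> (t - s) * z * (exp (- s * z) - exp (- t * z))"
    using tangent[of t s] by (simp add: algebra_simps)
  moreover have "\<dots> \<le> \<bar>t - s\<bar> * z * (\<bar>t - s\<bar> * (z * exp (- s0 * z)))"
  proof -
    have "\<bar>exp (- s * z) - exp (- t * z)\<bar> \<le> \<bar>t - s\<bar> * (z * exp (- s0 * z))"
      using less[of s t] less[of t s] assms by (auto simp: abs_le_iff abs_minus_commute)
    then have "\<bar>(t - s) * z\<bar> * \<bar>exp (- s * z) - exp (- t * z)\<bar> \<le> \<bar>(t - s) * z\<bar> * (\<bar>t - s\<bar> * (z * exp (- s0 * z)))"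
      by (intro mult_left_mono) auto
    then show ?thesis using assms by (simp add: abs_mult) (metis abs_le_D1 abs_mult abs_of_nonneg mult.assoc)
  qed
  moreover have "\<bar>t - s\<bar> * z * (\<bar>t - s\<bar> * (z * exp (- s0 * z))) = (t - s)\<^sup>2 * (z\<^sup>2 * exp (- s0 * z))"
    by (simp add: power2_eq_square mult_ac flip: abs_mult)
  ultimately show ?thesis by linarith
qed

section \<open>Laplace integrals of \<open>A\<close> and the concavity of
  \<open>ln g\<close>\<close>

context kanter
begin

abbreviation \<nu> :: "real measure" where "\<nu> \<equiv> restrict_space lborel {0<..<pi}"

lemma space_\<nu>: "space \<nu> = {0<..<pi}"
  by (simp add: space_restrict_space)

lemma finite_\<nu>: "finite_measure \<nu>"
  by (intro finite_measureI) (simp add: emeasure_restrict_space space_restrict_space)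

lemma borel_A [measurable]: "A \<in> borel_measurable borel"
  unfolding A_def by measurable

lemma borel_phi [measurable]: "phi \<in> borel_measurable borel"
  unfolding phi_def rho_def by measurable

lemma measurable_\<nu>: "f \<in> borel_measurable borel \<Longrightarrow> f \<in> borel_measurable \<nu>"
  by (intro measurable_restrict_space1) simp

lemma integrable_\<nu>_bounded:
  fixes f :: "real \<Rightarrow> real"
  assumes "f \<in> borel_measurable borel" "\<And>u. 0 < u \<Longrightarrow> u < pi \<Longrightarrow> \<bar>f u\<bar> \<le> C"
  shows "integrable \<nu> f"
  using assms finite_\<nu>
  by (intro finite_measure.integrable_const_bound[where B = C] measurable_\<nu> AE_I2)
     (auto simp: space_\<nu>)

lemma integral_\<nu>_pos:
  fixes f :: "real \<Rightarrow> real"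
  assumes "integrable \<nu> f" "\<And>u. 0 < u \<Longrightarrow> u < pi \<Longrightarrow> 0 < f u"
  shows "0 < (\<integral>u. f u \<partial>\<nu>)"
proof -
  have nn: "AE u in \<nu>. 0 \<le> f u"
    using assms(2) by (intro AE_I2) (auto simp: space_\<nu> less_imp_le)
  have "\<not> (AE u in \<nu>. f u = 0)"
  proof
    assume "AE u in \<nu>. f u = 0"
    moreover have "AE u in \<nu>. f u \<noteq> 0"
      using assms(2) by (intro AE_I2) (force simp: space_\<nu>)
    ultimately have "AE u in \<nu>. False" by eventually_elim simp
    then have "emeasure \<nu> (space \<nu>) = 0" by (simp add: eventually_False ae_filter_eq_bot_iff)
    then show False by (simp add: emeasure_restrict_space space_restrict_space)
  qed
  then have "(\<integral>u. f u \<partial>\<nu>) \<noteq> 0"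
    using integral_nonneg_eq_0_iff_AE[OF assms(1) nn] by simp
  then show ?thesis using Bochner_Integration.integral_nonneg_AE[OF nn] by simp
qed

text \<open>\<open>J 1\<close> is the function \<open>q\<close> of the overview and
  \<open>J 2\<close> is \<open>- q'\<close>.\<close>

definition J :: "nat \<Rightarrow> real \<Rightarrow> real" where
  "J k s = (\<integral>u. A u ^ k * exp (- s * A u) \<partial>\<nu>)"

text \<open>\<open>P s / J 2 s\<close> is the mean of \<open>phi\<close> under the weight
  \<open>exp (- s * A u) * (A u)\<^sup>2\<close>.\<close>

definition P :: "real \<Rightarrow> real" where
  "P s = (\<integral>u. exp (- s * A u) * (phi u * (A u)\<^sup>2) \<partial>\<nu>)"

lemma integrable_J: "0 < s \<Longrightarrow> integrable \<nu> (\<lambda>u. A u ^ k * exp (- s * A u))"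
  using A_pos power_mult_exp_le[of s _ k]
  by (intro integrable_\<nu>_bounded[where C = "(real k / s) ^ k"]) (auto simp: abs_mult less_imp_le)

lemma integrable_P: "0 < s \<Longrightarrow> integrable \<nu> (\<lambda>u. exp (- s * A u) * (phi u * (A u)\<^sup>2))"
proof (intro integrable_\<nu>_bounded[where C = "1 / a * (real 2 / s) ^ 2"])
  fix u assume s: "0 < s" and u: "0 < u" "u < pi"
  have "phi u * ((A u)\<^sup>2 * exp (- s * A u)) \<le> 1 / a * (real 2 / s) ^ 2"
    using phi_le[OF u] phi_nonneg[OF u] power_mult_exp_le[OF s, of "A u" 2] A_pos[OF u] a_pos
    by (intro mult_mono) auto
  then show "\<bar>exp (- s * A u) * (phi u * (A u)\<^sup>2)\<bar> \<le> 1 / a * (real 2 / s) ^ 2"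
    using phi_nonneg[OF u] by (simp add: abs_mult mult_ac)
qed simp

lemma J_pos: "0 < s \<Longrightarrow> 0 < J k s"
  unfolding J_def using A_pos by (intro integral_\<nu>_pos integrable_J) auto

text \<open>Differentiation under the integral, with error at most
  \<open>h\<^sup>2 * J (k + 2) (s / 2)\<close>: the parameter \<open>s / 2\<close> serves every
  \<open>t\<close> within distance \<open>s / 2\<close> of \<open>s\<close>.\<close>

lemma DERIV_J:
  assumes "0 < s"
  shows "(J k has_real_derivative - J (Suc k) s) (at s)"
proof -
  define C where "C = J (Suc (Suc k)) (s / 2)"
  have bound: "\<bar>J k t - J k s + (t - s) * J (Suc k) s\<bar> \<le> (t - s)\<^sup>2 * C" if "\<bar>t - s\<bar> < s / 2" for t
  proof -
    have "s - t < s / 2" using that by linarith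
    then have t: "0 < t" "s / 2 \<le> t" using assms by auto
    have int: "integrable \<nu> (\<lambda>u. A u ^ k * exp (- t * A u))" "integrable \<nu> (\<lambda>u. A u ^ k * exp (- s * A u))"
      "integrable \<nu> (\<lambda>u. A u ^ Suc k * exp (- s * A u))" "integrable \<nu> (\<lambda>u. A u ^ Suc (Suc k) * exp (- (s / 2) * A u))"
      using t assms by (intro integrable_J; simp)+
    have 1: "J k t - J k s + (t - s) * J (Suc k) s = (\<integral>u. A u ^ k * exp (- t * A u)
        - A u ^ k * exp (- s * A u) + (t - s) * (A u ^ Suc k * exp (- s * A u)) \<partial>\<nu>)"
      unfolding J_def using int by (simp del: power_Suc)
    have "\<bar>J k t - J k s + (t - s) * J (Suc k) s\<bar> \<le> (\<integral>u. (t - s)\<^sup>2 * (A u ^ Suc (Suc k) * exp (- (s / 2) * A u)) \<partial>\<nu>)"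
      unfolding 1 real_norm_def[symmetric]
    proof (rule Bochner_Integration.integral_norm_bound_integral)
      fix u assume "u \<in> space \<nu>"
      then have pos: "0 < A u" using A_pos by (simp add: space_\<nu>)
      have "A u ^ k * exp (- t * A u) - A u ^ k * exp (- s * A u) + (t - s) * (A u ^ Suc k * exp (- s * A u))
          = A u ^ k * (exp (- t * A u) - exp (- s * A u) + (t - s) * (A u * exp (- s * A u)))"
        by (simp add: algebra_simps)
      also have "norm \<dots> = A u ^ k * \<bar>exp (- t * A u) - exp (- s * A u) + (t - s) * (A u * exp (- s * A u))\<bar>"
        using pos by (simp add: abs_mult)
      also have "\<dots> \<le> A u ^ k * ((t - s)\<^sup>2 * ((A u)\<^sup>2 * exp (- (s / 2) * A u)))"
        using pos t assms by (intro mult_left_mono exp_taylor_bound) auto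
      also have "\<dots> = (t - s)\<^sup>2 * (A u ^ Suc (Suc k) * exp (- (s / 2) * A u))"
        by (simp add: power2_eq_square)
      finally show "norm (A u ^ k * exp (- t * A u) - A u ^ k * exp (- s * A u)
          + (t - s) * (A u ^ Suc k * exp (- s * A u))) \<le> (t - s)\<^sup>2 * (A u ^ Suc (Suc k) * exp (- (s / 2) * A u))" .
    qed (intro Bochner_Integration.integrable_add Bochner_Integration.integrable_diff integrable_mult_right int)+
    also have "\<dots> = (t - s)\<^sup>2 * C"
      unfolding C_def J_def by (rule integral_mult_right_zero)
    finally show ?thesis .
  qed
  have "((\<lambda>h. (J k (s + h) - J k s) / h - - J (Suc k) s) \<longlongrightarrow> 0) (at 0)"
  proof (rule Lim_null_comparison)
    show "((\<lambda>h. \<bar>h\<bar> * C) \<longlongrightarrow> 0) (at 0)" by (auto intro!: tendsto_eq_intros)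
    have "\<forall>\<^sub>F h in at 0. \<bar>h\<bar> < s / 2 \<and> h \<noteq> 0"
      using assms by (auto simp: eventually_at intro!: exI[of _ "s / 2"])
    then show "\<forall>\<^sub>F h in at 0. norm ((J k (s + h) - J k s) / h - - J (Suc k) s) \<le> \<bar>h\<bar> * C"
    proof eventually_elim
      case (elim h)
      have "norm ((J k (s + h) - J k s) / h - - J (Suc k) s) = \<bar>J k (s + h) - J k s + h * J (Suc k) s\<bar> / \<bar>h\<bar>"
        using elim by (simp add: field_simps flip: abs_divide)
      also have "\<dots> \<le> h\<^sup>2 * C / \<bar>h\<bar>"
        using bound[of "s + h"] elim by (intro divide_right_mono) auto
      also have "\<dots> = \<bar>h\<bar> * C"
        using elim by (simp add: power2_eq_square field_simps abs_if)
      finally show ?case .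
    qed
  qed
  then show ?thesis unfolding DERIV_def by (rule LIM_zero_cancel)
qed

text \<open>Integration by parts, using \<open>m' = A\<close> and \<open>m A' = phi A\<^sup>2\<close>.\<close>

lemma J_eq_P:
  assumes s: "0 < s"
  shows "J 1 s = s * P s"
proof -
  define F where "F = (\<lambda>u. m u * exp (- s * A u))"
  define f where "f = (\<lambda>u. A u * exp (- s * A u) - s * (exp (- s * A u) * (phi u * (A u)\<^sup>2)))"
  have J1: "integrable \<nu> (\<lambda>u. A u * exp (- s * A u))" using integrable_J[OF s, of 1] by simp
  have int_f: "integrable \<nu> f"
    unfolding f_def by (intro Bochner_Integration.integrable_diff integrable_mult_right J1 integrable_P s)
  have DF: "(F has_real_derivative f u) (at u)" if u: "0 < u" "u < pi" for u
    unfolding F_def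
    by (rule derivative_eq_intros DERIV_m DERIV_A u refl)+
      (use m_pos[OF u] in \<open>simp add: f_def field_simps\<close>)
  have cont: "isCont f u" if u: "0 < u" "u < pi" for u
  proof -
    have "isCont A u" "isCont rho u" using DERIV_isCont[OF DERIV_A[OF u]] DERIV_isCont[OF DERIV_rho[OF u]] by auto
    then show ?thesis unfolding f_def phi_def using a_pos by (intro continuous_intros) auto
  qed
  \<comment> \<open>Although \<open>m\<close> is unbounded near \<open>pi\<close>,
    \<open>m_le\<close> and \<open>z * exp (- s * z) \<le> 1 / s\<close> reduce \<open>F\<close> to
    a multiple of \<open>sin u\<close>.\<close>
  have F_bound: "norm (F u) \<le> b / a / s * sin u" if u: "0 < u" "u < pi" for u
  proof -
    have "m u * exp (- s * A u) \<le> b / a * sin u * A u * exp (- s * A u)"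
      using m_le[OF u] by (intro mult_right_mono) auto
    also have "\<dots> = b / a * sin u * (A u ^ 1 * exp (- s * A u))" by simp
    also have "\<dots> \<le> b / a * sin u * (real 1 / s) ^ 1"
      using sin_ab_pos[OF u] a_pos b_pos s A_pos[OF u]
      by (intro mult_left_mono power_mult_exp_le) auto
    finally show ?thesis using m_pos[OF u] by (simp add: F_def abs_mult)
  qed
  have F0: "(F \<longlongrightarrow> 0) (at_right 0)"
  proof (rule Lim_null_comparison)
    show "\<forall>\<^sub>F u in at_right 0. norm (F u) \<le> b / a / s * sin u"
      using eventually_at_right_real[of 0 pi] F_bound by (auto elim: eventually_mono)
    show "((\<lambda>u. b / a / s * sin u) \<longlongrightarrow> 0) (at_right 0)" by (rule tendsto_eq_intros refl | simp)+
  qed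
  have Fpi: "(F \<longlongrightarrow> 0) (at_left pi)"
  proof (rule Lim_null_comparison)
    show "\<forall>\<^sub>F u in at_left pi. norm (F u) \<le> b / a / s * sin u"
      using eventually_at_left_real[of 0 pi] F_bound by (auto elim: eventually_mono)
    show "((\<lambda>u. b / a / s * sin u) \<longlongrightarrow> 0) (at_left pi)" by (rule tendsto_eq_intros refl | simp)+
  qed
  have "(LBINT u=ereal 0..ereal pi. f u) = 0 - 0"
  proof (rule interval_integral_FTC_integrable)
    show "((F \<circ> real_of_ereal) \<longlongrightarrow> 0) (at_right (ereal 0))" "((F \<circ> real_of_ereal) \<longlongrightarrow> 0) (at_left (ereal pi))"
      using F0 Fpi unfolding ereal_tendsto_simps by simp_all
    show "set_integrable lborel (einterval (ereal 0) (ereal pi)) f"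
      using int_f by (simp add: set_integrable_def integrable_restrict_space mult.commute)
  qed (use DF cont in \<open>auto simp flip: has_real_derivative_iff_has_vector_derivative\<close>)
  then have "(\<integral>u. f u \<partial>\<nu>) = 0"
    by (simp add: interval_integral_Ioo set_lebesgue_integral_def integral_restrict_space)
  then show ?thesis
    using J1 integrable_P[OF s] unfolding f_def J_def P_def by simp
qed

lemma P_pos: "0 < s \<Longrightarrow> 0 < P s"
  using J_eq_P[of s] J_pos[of s 1] by (simp add: zero_less_mult_iff)

text \<open>Andreief's inequality for \<open>exp (- s * A)\<close>, \<open>exp (- t * A)\<close>
  against \<open>phi * A\<^sup>2\<close>, \<open>A\<^sup>2\<close>. Both determinants are
  nonpositive for \<open>x \<le> y\<close>, as \<open>A\<close> and \<open>phi\<close> are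
  nondecreasing.\<close>

lemma ratio_mono:
  assumes s: "0 < s" "s \<le> t"
  shows "J 2 s / P s \<le> J 2 t / P t"
proof -
  let ?E = "\<lambda>s u. exp (- s * A u)"
  have int: "integrable \<nu> (\<lambda>u. ?E r u * (A u)\<^sup>2)" if "0 < r" for r
    using integrable_J[OF that, of 2] by (simp add: mult.commute)
  have step: "0 \<le> (?E s x * ?E t y - ?E s y * ?E t x) * (phi x * (A x)\<^sup>2 * (A y)\<^sup>2 - phi y * (A y)\<^sup>2 * (A x)\<^sup>2)"
    if "0 < x" "x \<le> y" "y < pi" for x y
  proof -
    have "(t - s) * A x \<le> (t - s) * A y"
      using A_mono[OF that] s by (intro mult_left_mono) auto
    then have "?E s x * ?E t y \<le> ?E s y * ?E t x"
      by (simp add: algebra_simps flip: exp_add)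
    moreover have "phi x * ((A x)\<^sup>2 * (A y)\<^sup>2) \<le> phi y * ((A x)\<^sup>2 * (A y)\<^sup>2)"
      using phi_mono[OF that] by (intro mult_right_mono) auto
    ultimately show ?thesis by (intro mult_nonpos_nonpos) (auto simp: mult_ac)
  qed
  have "(\<integral>u. ?E s u * (A u)\<^sup>2 \<partial>\<nu>) * (\<integral>u. ?E t u * (phi u * (A u)\<^sup>2) \<partial>\<nu>)
     \<le> (\<integral>u. ?E s u * (phi u * (A u)\<^sup>2) \<partial>\<nu>) * (\<integral>u. ?E t u * (A u)\<^sup>2 \<partial>\<nu>)"
  proof (rule andreief_nonneg)
    fix x y assume "x \<in> space \<nu>" "y \<in> space \<nu>"
    then show "0 \<le> (?E s x * ?E t y - ?E s y * ?E t x) * (phi x * (A x)\<^sup>2 * (A y)\<^sup>2 - phi y * (A y)\<^sup>2 * (A x)\<^sup>2)"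
      using step[of x y] step[of y x] by (cases x y rule: le_cases) (auto simp: space_\<nu> algebra_simps)
  qed (intro integrable_P int; use s in simp)+
  then have "J 2 s * P t \<le> P s * J 2 t"
    by (simp add: J_def P_def mult.commute)
  then show ?thesis using P_pos[of s] P_pos[of t] s by (simp add: field_simps)
qed

text \<open>The density of \<open>ln (L / A U)\<close>.\<close>

definition g :: "real \<Rightarrow> real" where
  "g t = exp t * J 1 (exp t) / pi"

lemma g_pos: "0 < g t"
  by (simp add: g_def J_pos)

text \<open>At \<open>s = exp t\<close> the derivative of \<open>ln g\<close> is
  \<open>1 - s * J 2 s / J 1 s\<close>, which \<open>J_eq_P\<close> turns into
  \<open>1 - J 2 s / P s\<close>.\<close>

lemma concave_ln_g: "concave_on UNIV (\<lambda>t. ln (g t))"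
  unfolding concave_on_def
proof (rule convex_on_realI)
  fix t :: real
  have "(g has_real_derivative g t - exp t * (exp t * J 2 (exp t)) / pi) (at t)"
    unfolding g_def
    by (rule derivative_eq_intros DERIV_chain2[OF DERIV_J] refl | simp)+
       (simp add: g_def field_simps numeral_2_eq_2)
  then have "((\<lambda>t. - ln (g t)) has_real_derivative - ((g t - exp t * (exp t * J 2 (exp t)) / pi) / g t)) (at t)"
    using g_pos[of t] by (auto intro!: derivative_eq_intros)
  also have "- ((g t - exp t * (exp t * J 2 (exp t)) / pi) / g t) = J 2 (exp t) / P (exp t) - 1"
    using J_pos[of "exp t" 1] P_pos[of "exp t"] J_eq_P[of "exp t"]
    by (simp add: g_def field_simps)
  finally show "((\<lambda>t. - ln (g t)) has_real_derivative J 2 (exp t) / P (exp t) - 1) (at t)" .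
qed (auto intro!: ratio_mono)


section \<open>Identification of the law of \<open>Z\<close> and the density\<close>

lemma borel_g [measurable]: "g \<in> borel_measurable borel"
proof -
  have "isCont g t" for t
    unfolding g_def using DERIV_isCont[OF DERIV_J[of "exp t" 1]]
    by (intro continuous_intros isCont_o2[where f = exp and g = "J 1"]) auto
  then show ?thesis
    by (intro borel_measurable_continuous_onI) (simp add: continuous_on_eq_continuous_within)
qed

text \<open>By Fubini the moment of order \<open>b * n\<close> of \<open>L / A U\<close> is
  \<open>Gamma (1 + b * n)\<close> times the mean of \<open>A U powr (- b * n)\<close>. The Gamma
  factor cancels an \<open>rGamma\<close> in \<open>A_powr_integral\<close>, leaving the moments of
  \<open>Z powr - a\<close>.\<close>

lemma g_moments:
  fixes n :: nat
  shows "(\<integral>\<^sup>+t. ennreal (exp (b * t) ^ n) * ennreal (g t) \<partial>lborel) = ennreal (fact n / Gamma (1 + a * real n))"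
proof -
  interpret finite_measure \<nu> by (rule finite_\<nu>)
  interpret pair_sigma_finite lborel \<nu> ..
  have [measurable]: "A \<in> borel_measurable \<nu>" by (intro measurable_\<nu>) simp
  have z: "0 < 1 + b * real n" "0 < 1 + a * real n" using a_pos b_pos by (auto intro!: add_pos_nonneg)
  have "(\<integral>\<^sup>+t. ennreal (exp (b * t) ^ n) * ennreal (g t) \<partial>lborel)
      = (\<integral>\<^sup>+t. \<integral>\<^sup>+u. ennreal (A u / pi) * ennreal (exp ((1 + b * real n) * t) * exp (- A u * exp t)) \<partial>\<nu> \<partial>lborel)"
  proof (rule nn_integral_cong)
    fix t :: real
    have *: "ennreal (J 1 (exp t)) = (\<integral>\<^sup>+u. ennreal (A u ^ 1 * exp (- exp t * A u)) \<partial>\<nu>)"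
      unfolding J_def using A_pos
      by (intro nn_integral_eq_integral[symmetric] integrable_J) (auto simp: space_\<nu> less_imp_le intro!: AE_I2)
    have "ennreal (exp (b * t) ^ n) * ennreal (g t)
        = ennreal (exp (b * t) ^ n * exp t / pi) * (\<integral>\<^sup>+u. ennreal (A u ^ 1 * exp (- exp t * A u)) \<partial>\<nu>)"
      unfolding *[symmetric] using J_pos[of "exp t" 1]
      by (simp add: g_def less_imp_le flip: ennreal_mult)
    also have "\<dots> = (\<integral>\<^sup>+u. ennreal (exp (b * t) ^ n * exp t / pi) * ennreal (A u ^ 1 * exp (- exp t * A u)) \<partial>\<nu>)"
      by (rule nn_integral_cmult[symmetric]) measurable
    also have "\<dots> = (\<integral>\<^sup>+u. ennreal (A u / pi) * ennreal (exp ((1 + b * real n) * t) * exp (- A u * exp t)) \<partial>\<nu>)"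
    proof (rule nn_integral_cong)
      fix u assume "u \<in> space \<nu>"
      then have "0 < A u" using A_pos by (simp add: space_\<nu>)
      moreover have "exp ((1 + b * real n) * t) = exp (b * t) ^ n * exp t"
        by (simp add: algebra_simps flip: exp_of_nat_mult exp_add)
      ultimately show "ennreal (exp (b * t) ^ n * exp t / pi) * ennreal (A u ^ 1 * exp (- exp t * A u))
          = ennreal (A u / pi) * ennreal (exp ((1 + b * real n) * t) * exp (- A u * exp t))"
        by (simp add: mult_ac flip: ennreal_mult)
    qed
    finally show "ennreal (exp (b * t) ^ n) * ennreal (g t)
        = (\<integral>\<^sup>+u. ennreal (A u / pi) * ennreal (exp ((1 + b * real n) * t) * exp (- A u * exp t)) \<partial>\<nu>)" .
  qed
  also have "\<dots> = (\<integral>\<^sup>+u. \<integral>\<^sup>+t. ennreal (A u / pi) * ennreal (exp ((1 + b * real n) * t) * exp (- A u * exp t)) \<partial>lborel \<partial>\<nu>)"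
    by (rule Fubini'[symmetric]) measurable
  also have "\<dots> = (\<integral>\<^sup>+u. ennreal (Gamma (1 + b * real n) / pi * A u powr (- b * real n)) \<partial>\<nu>)"
  proof (rule nn_integral_cong)
    fix u assume "u \<in> space \<nu>"
    then have pos: "0 < A u" using A_pos by (simp add: space_\<nu>)
    have "(\<integral>\<^sup>+t. ennreal (A u / pi) * ennreal (exp ((1 + b * real n) * t) * exp (- A u * exp t)) \<partial>lborel)
        = ennreal (A u / pi) * ennreal (Gamma (1 + b * real n) * A u powr - (1 + b * real n))"
      using nn_integral_Gamma_exp[OF z(1) pos] by (subst nn_integral_cmult) auto
    also have "A u powr - (1 + b * real n) = A u powr (- b * real n) / A u"
      using pos by (simp add: powr_diff powr_minus divide_inverse powr_add)
    also have "ennreal (A u / pi) * ennreal (Gamma (1 + b * real n) * (A u powr (- b * real n) / A u))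
        = ennreal (Gamma (1 + b * real n) / pi * A u powr (- b * real n))"
      using pos Gamma_real_pos[OF z(1)] by (simp add: less_imp_le flip: ennreal_mult)
    finally show "(\<integral>\<^sup>+t. ennreal (A u / pi) * ennreal (exp ((1 + b * real n) * t) * exp (- A u * exp t)) \<partial>lborel)
        = ennreal (Gamma (1 + b * real n) / pi * A u powr (- b * real n))" .
  qed
  also have "\<dots> = ennreal (\<integral>u. Gamma (1 + b * real n) / pi * A u powr (- b * real n) \<partial>\<nu>)"
  proof (rule nn_integral_eq_integral)
    show "integrable \<nu> (\<lambda>u. Gamma (1 + b * real n) / pi * A u powr (- b * real n))"
      using A_powr_integral(1)[of n]
      by (intro integrable_mult_right) (simp add: set_integrable_def integrable_restrict_space mult.commute)
  qed (use Gamma_real_pos[OF z(1)] in \<open>auto simp: less_imp_le intro!: AE_I2\<close>)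
  also have "(\<integral>u. Gamma (1 + b * real n) / pi * A u powr (- b * real n) \<partial>\<nu>)
      = Gamma (1 + b * real n) / pi * (pi * (fact n * rGamma (1 + a * real n) * rGamma (1 + b * real n)))"
    using A_powr_integral(2)[of n]
    by (simp add: set_lebesgue_integral_def integral_restrict_space)
  also have "\<dots> = fact n / Gamma (1 + a * real n)"
    using Gamma_real_pos[OF z(1)] Gamma_real_pos[OF z(2)]
    by (simp add: rGamma_inverse_Gamma field_simps)
  finally show ?thesis .
qed

lemma MSU_stable:
  fixes M :: "'a measure" and Z :: "'a \<Rightarrow> real"
  assumes M: "prob_space M" and Z: "positive_stable M a Z"
  shows "MSU M Z"
proof -
  interpret prob_space M by fact
  have Zm[measurable]: "Z \<in> borel_measurable M" and Zpos: "AE \<omega> in M. 0 < Z \<omega>"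
    using Z by (auto simp: positive_stable_def positive_rv_def)
  define D where "D = density lborel (\<lambda>t. ennreal (g t))"
  have [measurable_cong]: "sets D = sets borel" by (simp add: D_def)
  have D: "prob_space D"
    using g_moments[of 0] by (intro prob_spaceI) (simp add: D_def emeasure_density)
  \<comment> \<open>Kanter's factorization: \<open>Z powr - a\<close> has the law of
    \<open>(L / A U) powr b\<close>. Inverting the power makes \<open>ln Z\<close> distributed as
    \<open>- (b / a) * t\<close> with \<open>t\<close> of density \<open>g\<close>.\<close>
  have "distr M borel (\<lambda>\<omega>. Z \<omega> powr - a) = distr D borel (\<lambda>t. exp (b * t))"
  proof (rule distr_eqI_moments[where c = "\<lambda>n. fact n / Gamma (1 + a * real n)"])
    show "(\<integral>\<^sup>+t. ennreal (exp (b * t) ^ n) \<partial>D) = ennreal (fact n / Gamma (1 + a * real n))" for n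
      using g_moments[of n] by (simp add: D_def nn_integral_density mult.commute)
    have "0 < 1 + a * real n" for n using a_pos by (simp add: add_pos_nonneg)
    then show "0 \<le> fact n / Gamma (1 + a * real n)" for n
      by (simp add: Gamma_real_pos less_imp_le)
    show "(\<lambda>n. t ^ n / fact n * (fact n / Gamma (1 + a * real n))) \<longlonglongrightarrow> 0" for t
      using power_div_Gamma_tendsto_0[OF a_pos, of t] by simp
  qed (use M D Z a_pos in \<open>auto intro!: positive_stable_moments\<close>)
  then have "distr (distr M borel (\<lambda>\<omega>. Z \<omega> powr - a)) borel (\<lambda>x. x powr - (1 / a))
      = distr (distr D borel (\<lambda>t. exp (b * t))) borel (\<lambda>x. x powr - (1 / a))"
    by simp
  also have "distr (distr M borel (\<lambda>\<omega>. Z \<omega> powr - a)) borel (\<lambda>x. x powr - (1 / a))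
      = distr M borel (\<lambda>\<omega>. (Z \<omega> powr - a) powr - (1 / a))"
    by (subst distr_distr) (auto simp: o_def)
  also have "\<dots> = distr M borel Z"
    by (rule distr_cong_AE) (use Zpos a_pos in \<open>auto simp: powr_powr\<close>)
  also have "distr (distr D borel (\<lambda>t. exp (b * t))) borel (\<lambda>x. x powr - (1 / a))
      = distr D borel (\<lambda>t. exp (- (b / a) * t))"
    by (subst distr_distr) (auto simp: o_def powr_def)
  finally have law: "distr M borel Z = distr D borel (\<lambda>t. exp (- (b / a) * t))" .

  define f where "f = (\<lambda>x. if 0 < x then a / b * g (- (a / b) * ln x) / x else 0)"
  have f_exp: "f (exp t) = a / b * g (- (a / b) * t) / exp t" for t by (simp add: f_def)
  have fm[measurable]: "f \<in> borel_measurable borel" unfolding f_def by measurable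
  have "distr M lborel Z = density lborel (\<lambda>x. ennreal (f x))"
  proof (rule measure_eqI)
    fix S assume "S \<in> sets (distr M lborel Z)"
    then have S[measurable]: "S \<in> sets borel" by simp
    have "emeasure (distr M lborel Z) S = emeasure (distr M borel Z) S"
      by (simp add: emeasure_distr)
    also have "\<dots> = (\<integral>\<^sup>+x. indicator S x \<partial>distr M borel Z)"
      by (rule nn_integral_indicator[symmetric]) simp
    also have "\<dots> = (\<integral>\<^sup>+t. indicator S (exp (- (b / a) * t)) \<partial>D)"
      unfolding law by (rule nn_integral_distr) measurable
    also have "\<dots> = (\<integral>\<^sup>+t. ennreal (g t) * indicator S (exp (- (b / a) * t)) \<partial>lborel)"
      by (simp add: D_def nn_integral_density)
    also have "\<dots> = ennreal (a / b) * (\<integral>\<^sup>+t. ennreal (g (- (a / b) * t)) * indicator S (exp t) \<partial>lborel)"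
      by (subst nn_integral_real_affine[where c = "- (a / b)" and t = 0]) (use a_pos b_pos in auto)
    also have "\<dots> = (\<integral>\<^sup>+t. ennreal (a / b) * (ennreal (g (- (a / b) * t)) * indicator S (exp t)) \<partial>lborel)"
      by (rule nn_integral_cmult[symmetric]) measurable
    also have "\<dots> = (\<integral>\<^sup>+t. ennreal (f (exp t)) * indicator S (exp t) * ennreal (exp t) \<partial>lborel)"
      using a_pos b_pos g_pos
      by (intro nn_integral_cong) (auto simp: f_exp less_imp_le split: split_indicator simp flip: ennreal_mult)
    also have "\<dots> = (\<integral>\<^sup>+x. ennreal (f x) * indicator S x * indicator {0<..} x \<partial>lborel)"
      by (rule nn_integral_exp_substitution[symmetric]) measurable
    also have "\<dots> = (\<integral>\<^sup>+x. ennreal (f x) * indicator S x \<partial>lborel)"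
      by (intro nn_integral_cong) (auto simp: f_def split: split_indicator)
    also have "\<dots> = emeasure (density lborel (\<lambda>x. ennreal (f x))) S"
      by (simp add: emeasure_density)
    finally show "emeasure (distr M lborel Z) S = emeasure (density lborel (\<lambda>x. ennreal (f x))) S" .
  qed simp
  then have "distributed M lborel Z (\<lambda>x. ennreal (f x))"
    by (simp add: distributed_def)
  moreover have "\<forall>x\<le>0. f x = 0" by (simp add: f_def)
  moreover have "log_concave (\<lambda>t. f (exp t))"
  proof -
    have pos: "0 < f (exp t)" for t using a_pos b_pos g_pos by (simp add: f_exp)
    let ?h = "\<lambda>t. ln (g (- (a / b) * t))"
    \<comment> \<open>The reflected scaling preserves concavity, and the Jacobian adds only the
      linear term \<open>- t\<close>.\<close>
    have ln_f: "ln (f (exp t)) = ln (a / b) + ?h t - t" for t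
      using a_pos b_pos g_pos[of "- (a / b) * t"] by (simp add: f_exp ln_mult ln_div)
    have "concave_on UNIV (\<lambda>t. ln (f (exp t)))"
      unfolding concave_on_iff
    proof (intro conjI ballI allI impI)
      fix x y u v :: real assume uv: "0 \<le> u" "0 \<le> v" "u + v = 1"
      have "u * ?h x + v * ?h y \<le> ln (g (u *\<^sub>R (- (a / b) * x) + v *\<^sub>R (- (a / b) * y)))"
        using concave_ln_g uv unfolding concave_on_iff by blast
      also have "u *\<^sub>R (- (a / b) * x) + v *\<^sub>R (- (a / b) * y) = - (a / b) * (u *\<^sub>R x + v *\<^sub>R y)"
        by (simp add: algebra_simps)
      finally have "u * ?h x + v * ?h y \<le> ?h (u *\<^sub>R x + v *\<^sub>R y)" .
      moreover have "u * ln (a / b) + v * ln (a / b) = ln (a / b)"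
        using uv by (simp flip: distrib_right)
      ultimately show "u * ln (f (exp x)) + v * ln (f (exp y)) \<le> ln (f (exp (u *\<^sub>R x + v *\<^sub>R y)))"
        unfolding ln_f by (simp add: algebra_simps)
    qed simp
    then show ?thesis using pos by (simp add: log_concave_def less_imp_le)
  qed
  ultimately show ?thesis using Zm Zpos by (auto simp: MSU_def positive_rv_def)
qed

end

theorem mainTheorem1:
  fixes M :: "'a measure" and Z :: "'a \<Rightarrow> real" and \<alpha> :: real
  assumes "prob_space M"
    and "0 < \<alpha>" and "\<alpha> < 1"
    and "positive_stable M \<alpha> Z"
  shows "MSU M Z \<longleftrightarrow> \<alpha> \<le> 1 / 2"
proof
  assume "MSU M Z"
  then show "\<alpha> \<le> 1 / 2" using assms by (intro MSU_imp_le_half)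
next
  assume "\<alpha> \<le> 1 / 2"
  then have "kanter \<alpha> (1 - \<alpha>)" using assms by unfold_locales auto
  then show "MSU M Z" using assms by (intro kanter.MSU_stable)
qed

end
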